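(* Let $F\in\mathrm{Diff}(\mathbb{C}^2,0)$ be a germ with the finite orbits property. Then at least one eigenvalue of $D_0F$ is a root of unity, and all eigenvalues of $D_0F$ belong to the unit circle.
   Context: $\mathrm{Diff}(\mathbb{C}^2,0)$ is the group of germs at $0$ of biholomorphisms of $\mathbb{C}^2$ fixing $0$. For a representative $F:U\to V$ (a biholomorphism between open neighborhoods of $0$ with $F(0)=0$), $A\subset U\cap V$ and $p\in A$, put $O^+_{F,A}(p)=\{F^j(p): j\ge 0,\ F^k(p)\in A\text{ for all }0\le k\le j\}$ and $O_{F,A}(p)=O^+_{F,A}(p)\cup O^+_{F^{-1},A}(p)$. $F$ has the finite orbits property in $A$ if $O_{F,A}(p)$ is finite for all $p\in A$. A germ $F$ has the finite orbits property if there exist a representative $F:U\to V$ and a neighborhood $A\subset U\cap V$ of $0$ such that $F$ has the finite orbits property in $A$. *)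

theory Defs
  imports "HOL-Analysis.Analysis"
begin

type_synonym C2 = "complex ^ 2"

text \<open>Holomorphy in several variables: \<open>has_derivative\<close> only yields a real-linear
  derivative, so complex linearity is required explicitly.\<close>

definition holomorphic_C2 :: "(C2 \<Rightarrow> C2) \<Rightarrow> C2 set \<Rightarrow> bool" where
  "holomorphic_C2 F U \<longleftrightarrow>
     (\<forall>z\<in>U. \<exists>L. (F has_derivative L) (at z) \<and> Vector_Spaces.linear (*s) (*s) L)"

text \<open>A map \<open>F : U \<rightarrow> V\<close> is encoded by a total function of which only the values on
  \<open>U\<close> matter; its inverse is \<open>inv_into U F\<close>.\<close>

definition local_biholomorphism :: "(C2 \<Rightarrow> C2) \<Rightarrow> C2 set \<Rightarrow> C2 set \<Rightarrow> bool" where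
  "local_biholomorphism F U V \<longleftrightarrow>
     open U \<and> open V \<and> 0 \<in> U \<and> 0 \<in> V \<and> F 0 = 0 \<and> bij_betw F U V \<and>
     holomorphic_C2 F U \<and> holomorphic_C2 (inv_into U F) V"

definition germ :: "(C2 \<Rightarrow> C2) \<Rightarrow> (C2 \<Rightarrow> C2) set" where
  "germ F = {G. eventually (\<lambda>z. G z = F z) (nhds 0)}"

definition Diff0 :: "(C2 \<Rightarrow> C2) set set" where
  "Diff0 = {germ F | F. \<exists>U V. local_biholomorphism F U V}"

definition representative :: "(C2 \<Rightarrow> C2) set \<Rightarrow> (C2 \<Rightarrow> C2) \<Rightarrow> C2 set \<Rightarrow> C2 set \<Rightarrow> bool" where
  "representative \<phi> F U V \<longleftrightarrow> local_biholomorphism F U V \<and> germ F = \<phi>"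

text \<open>In \<open>pos_orbit\<close> every iterate up to \<open>j\<close> lies in \<open>A\<close>, so the totalised map is only
  ever applied to points of \<open>A\<close>.\<close>

definition pos_orbit :: "(C2 \<Rightarrow> C2) \<Rightarrow> C2 set \<Rightarrow> C2 \<Rightarrow> C2 set" where
  "pos_orbit F A p = {(F ^^ j) p | j. \<forall>k\<le>j. (F ^^ k) p \<in> A}"

definition orbit :: "(C2 \<Rightarrow> C2) \<Rightarrow> C2 set \<Rightarrow> C2 set \<Rightarrow> C2 \<Rightarrow> C2 set" where
  "orbit F U A p = pos_orbit F A p \<union> pos_orbit (inv_into U F) A p"

definition finite_orbits_in :: "(C2 \<Rightarrow> C2) \<Rightarrow> C2 set \<Rightarrow> C2 set \<Rightarrow> bool" where
  "finite_orbits_in F U A \<longleftrightarrow> (\<forall>p\<in>A. finite (orbit F U A p))"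

definition finite_orbits_property :: "(C2 \<Rightarrow> C2) set \<Rightarrow> bool" where
  "finite_orbits_property \<phi> \<longleftrightarrow>
     (\<exists>F U V A. representative \<phi> F U V \<and> A \<subseteq> U \<inter> V \<and> 0 \<in> interior A \<and>
        finite_orbits_in F U A)"

definition germ_derivative :: "(C2 \<Rightarrow> C2) set \<Rightarrow> C2 \<Rightarrow> C2" where
  "germ_derivative \<phi> = (THE L. \<forall>F\<in>\<phi>. (F has_derivative L) (at 0))"

definition eigenvalue :: "(C2 \<Rightarrow> C2) \<Rightarrow> complex \<Rightarrow> bool" where
  "eigenvalue L c \<longleftrightarrow> (\<exists>v. v \<noteq> 0 \<and> L v = c *s v)"

definition root_of_unity :: "complex \<Rightarrow> bool" where
  "root_of_unity c \<longleftrightarrow> (\<exists>n\<ge>1. c ^ n = 1)"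

lemma germ_derivative_eq:
  assumes "(F has_derivative L) (at 0)"
  shows "germ_derivative (germ F) = L"
proof -
  have "(G has_derivative L) (at 0)" if "G \<in> germ F" for G
  proof -
    have "eventually (\<lambda>z. F z = G z) (nhds 0)"
      using that by (simp add: germ_def eq_commute)
    then obtain S where S: "open S" "0 \<in> S" "\<And>z. z \<in> S \<Longrightarrow> F z = G z"
      by (auto simp: eventually_nhds)
    show ?thesis
      using has_derivative_transform_within_open[OF assms S] by blast
  qed
  moreover have "F \<in> germ F"
    by (simp add: germ_def)
  ultimately show ?thesis
    unfolding germ_derivative_def
    by (intro the_equality) (auto dest: has_derivative_unique[OF assms])
qed

lemma germ_derivative_Diff0:
  assumes "\<phi> \<in> Diff0" "F \<in> \<phi>"
  shows "(F has_derivative germ_derivative \<phi>) (at 0)"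
    and "Vector_Spaces.linear (*s) (*s) (germ_derivative \<phi>)"
proof -
  obtain G U V where G: "\<phi> = germ G" "local_biholomorphism G U V"
    using assms(1) by (auto simp: Diff0_def)
  then obtain L where L: "(G has_derivative L) (at 0)" "Vector_Spaces.linear (*s) (*s) L"
    by (auto simp: local_biholomorphism_def holomorphic_C2_def)
  obtain S where S: "open S" "0 \<in> S" "\<And>z. z \<in> S \<Longrightarrow> G z = F z"
    using assms(2) G(1) by (auto simp: germ_def eventually_nhds)
  show "(F has_derivative germ_derivative \<phi>) (at 0)"
    using has_derivative_transform_within_open[OF L(1) S] germ_derivative_eq[OF L(1)] G(1) by simp
  show "Vector_Spaces.linear (*s) (*s) (germ_derivative \<phi>)"
    using L(2) germ_derivative_eq[OF L(1)] G(1) by simp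
qed

end

theory Submission
  imports Defs "HOL-Complex_Analysis.Conformal_Mappings"
begin

text \<open>Finiteness of the orbits means that a point whose orbit stays near the origin is periodic. An
  eigenvalue off the unit circle, at any periodic point, yields an expanding cone for \<open>F\<close> or its
  inverse and hence an infinite orbit converging to that point. So all multipliers of periodic points
  lie on the unit circle.

  Let \<open>K\<close> be the compact set of points whose orbit stays in a small ball around \<open>0\<close>. The component of
  \<open>0\<close> in \<open>K\<close> is a nontrivial continuum, since otherwise an isolating neighbourhood would contain an
  invariant set that is both compact and open. Multipliers are locally constant along curves of fixed
  points, because the nontrivial one is holomorphic of modulus 1; and near a periodic point whose
  multipliers are either 1 or not roots of unity there are no further periodic points of a multiple
  period. Hence a continuum of points of bounded period through such a point has that point's period.
  A Baire-type argument in the style of Sierpinski then shows that every continuum in \<open>K\<close> has bounded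
  period. If no eigenvalue at \<open>0\<close> were a root of unity, the component of \<open>0\<close> would consist of fixed
  points, although \<open>0\<close> is then an isolated fixed point.\<close>

section \<open>Pointwise periodic dynamics\<close>

text \<open>Two obstacles shape the argument. Where both multipliers equal 1, no local description
  of the nearby periodic points is available. Multipliers are therefore compared only along
  connected sets of a common period: every other value is locally constant, so such a set cannot mix
  it with the unipotent one. They are encoded by trace and determinant, which vary continuously with
  the point, so that no eigenvalue has to be followed. The second obstacle is that the sets of
  points of period \<open>n\<close> overlap, since a period can be multiplied, and the classical
  theorem of Sierpinski does not apply. What replaces disjointness is that trace and determinant
  take only countably many values for each period, and that each value determines one exponent
  turning every multiplier that is a root of unity into 1. That exponent fixes a period for every
  continuum of bounded period through a point of the class.\<close>

locale pointwise_periodic =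
  fixes F G :: "'a::euclidean_space \<Rightarrow> 'a" and A :: "'a set"
  assumes open_A: "open A"
    and cont_F: "continuous_on A F" and cont_G: "continuous_on A G"
    and GF: "z \<in> A \<Longrightarrow> G (F z) = z" and FG: "z \<in> A \<Longrightarrow> F (G z) = z"
    and periodic_F: "(\<And>k. (F ^^ k) p \<in> A) \<Longrightarrow> \<exists>n\<ge>1. (F ^^ n) p = p"
    and periodic_G: "(\<And>k. (G ^^ k) p \<in> A) \<Longrightarrow> \<exists>n\<ge>1. (G ^^ n) p = p"
begin

text \<open>Time reversal: whatever is proved for \<open>F\<close> becomes available for
  \<open>G\<close>.\<close>

lemma swap: "pointwise_periodic G F A"
  by unfold_locales (fact open_A cont_F cont_G GF FG periodic_F periodic_G)+

text \<open>\<open>F\<close> is controlled only on \<open>A\<close>, so this is the domain on which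
  the \<open>k\<close>-fold composition makes sense; with \<open>j < k\<close> the final value is
  allowed to leave \<open>A\<close>.\<close>

definition reach :: "nat \<Rightarrow> 'a set" where
  "reach k = {z. \<forall>j<k. (F ^^ j) z \<in> A}"

lemma reach_Suc: "reach (Suc k) = reach k \<inter> {z. (F ^^ k) z \<in> A}"
  by (auto simp: reach_def less_Suc_eq)

lemma reach_mono: "j \<le> k \<Longrightarrow> reach k \<subseteq> reach j"
  by (auto simp: reach_def)

lemma open_reach: "open (reach k)"
  and continuous_on_reach: "continuous_on (reach k) (F ^^ k)"
proof (induction k)
  case 0
  show "open (reach 0)" "continuous_on (reach 0) (F ^^ 0)"
    by (simp_all add: reach_def)
next
  case (Suc k)
  have "reach (Suc k) = reach k \<inter> (F ^^ k) -` A"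
    by (auto simp: reach_Suc)
  then show "open (reach (Suc k))"
    using continuous_open_preimage Suc open_A by metis
  show "continuous_on (reach (Suc k)) (F ^^ Suc k)"
    unfolding funpow.simps
    by (rule continuous_on_compose2[OF cont_F, unfolded o_def[symmetric]])
       (auto simp: reach_Suc intro: continuous_on_subset[OF Suc(2)])
qed

lemma tendsto_funpow:
  assumes "X \<longlonglongrightarrow> p" "p \<in> reach k"
  shows "(\<lambda>i. (F ^^ k) (X i)) \<longlonglongrightarrow> (F ^^ k) p"
proof -
  have "isCont (F ^^ k) p"
    using continuous_on_reach open_reach assms(2) continuous_on_eq_continuous_at by blast
  then show ?thesis
    using assms(1) isCont_tendsto_compose by blast
qed

lemma G_funpow_F: "z \<in> reach k \<Longrightarrow> j \<le> k \<Longrightarrow> (G ^^ j) ((F ^^ k) z) = (F ^^ (k - j)) z"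
proof (induction j)
  case (Suc j)
  then have "(F ^^ (k - Suc j)) z \<in> A" "k - j = Suc (k - Suc j)"
    by (auto simp: reach_def)
  with Suc show ?case
    by (simp add: GF)
qed simp

definition invariant_part :: "'a set \<Rightarrow> 'a set" where
  "invariant_part W = {p. \<forall>k. (F ^^ k) p \<in> W}"

lemma invariant_part_subset: "invariant_part W \<subseteq> W"
  by (auto simp: invariant_part_def dest: spec[where x = 0])

lemma invariant_part_reach: "W \<subseteq> A \<Longrightarrow> p \<in> invariant_part W \<Longrightarrow> p \<in> reach k"
  by (auto simp: invariant_part_def reach_def)

lemma funpow_invariant_part: "p \<in> invariant_part W \<Longrightarrow> (F ^^ k) p \<in> invariant_part W"
  by (simp add: invariant_part_def flip: funpow_add o_apply[of "F ^^ _" "F ^^ _"])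

lemma invariant_part_closed:
  assumes "closed W" "W \<subseteq> A"
  shows "closed (invariant_part W)"
proof (unfold closed_sequential_limits, intro allI impI, elim conjE)
  fix X p assume X: "\<forall>i. X i \<in> invariant_part W" "X \<longlonglongrightarrow> p"
  have "(F ^^ k) p \<in> W" for k
  proof (induction k rule: less_induct)
    case (less k)
    then have "p \<in> reach k"
      using assms(2) by (auto simp: reach_def)
    then show ?case
      by (intro closed_sequentially[OF assms(1) _ tendsto_funpow[OF X(2)]]) (use X(1) in \<open>auto simp: invariant_part_def\<close>)
  qed
  then show "p \<in> invariant_part W"
    by (simp add: invariant_part_def)
qed

lemma invariant_part_compact:
  assumes "compact W" "W \<subseteq> A"
  shows "compact (invariant_part W)"
  using invariant_part_closed[of W] assms invariant_part_subset
  by (meson bounded_subset compact_eq_bounded_closed)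

lemma invariant_part_periodic:
  "W \<subseteq> A \<Longrightarrow> p \<in> invariant_part W \<Longrightarrow> \<exists>n\<ge>1. (F ^^ n) p = p"
  by (rule periodic_F) (auto simp: invariant_part_def)

text \<open>A backward orbit that stays in \<open>W\<close> is a finite cycle, so \<open>F\<close>
  maps each of its points to another one; the forward orbit never leaves the cycle.\<close>

lemma backward_invariant:
  assumes "W \<subseteq> A" and q: "\<And>k. (G ^^ k) q \<in> W"
  shows "q \<in> invariant_part W"
proof -
  obtain n where n: "n \<ge> 1" "(G ^^ n) q = q"
    using periodic_G q assms(1) by blast
  have step: "\<exists>i. F ((G ^^ j) q) = (G ^^ i) q" for j
  proof -
    have *: "F ((G ^^ Suc i) q) = (G ^^ i) q" for i
      using FG q assms(1) by auto
    show ?thesis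
    proof (cases j)
      case 0
      obtain m where "n = Suc m" using n(1) by (cases n) auto
      then show ?thesis using * n(2) 0 by (metis funpow_0)
    qed (use * in blast)
  qed
  have "\<exists>i. (F ^^ k) q = (G ^^ i) q" for k
  proof (induction k)
    case 0 show ?case by (metis funpow_0)
  next
    case (Suc k) then show ?case using step by auto
  qed
  then have "(F ^^ k) q \<in> W" for k
    using q by metis
  then show ?thesis
    by (simp add: invariant_part_def)
qed

text \<open>If the component of a fixed point were trivial, one could choose an isolating neighbourhood
  \<open>W\<close>. A point that leaves \<open>closure W\<close> after a long time accumulates, just before it leaves, at a
  point whose backward orbit stays in \<open>closure W\<close>; by periodicity so does its forward orbit.
  Hence the maximal invariant set of \<open>closure W\<close> would be open and compact.\<close>

lemma ex_invariant_continuum: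
  assumes x: "F x = x" and r: "r > 0" "cball x r \<subseteq> A"
  shows "\<exists>X. compact X \<and> connected X \<and> x \<in> X \<and> X \<noteq> {x} \<and> X \<subseteq> invariant_part (cball x r)"
proof (rule ccontr)
  assume neg: "\<not> ?thesis"
  define K where "K = invariant_part (cball x r)"
  have fix_x: "(F ^^ k) x = x" for k
    by (induction k) (simp_all add: x)
  have xK: "x \<in> K"
    using r by (simp add: K_def invariant_part_def fix_x)
  have cK: "compact K"
    unfolding K_def using r by (intro invariant_part_compact) auto
  define T where "T = connected_component_set K x"
  have T: "T \<in> components K"
    using xK by (auto simp: T_def components_def)
  have cT: "compact T"
    using cK T by (rule compact_components)
  have "connected T" "T \<subseteq> K"
    using in_components_connected[OF T] in_components_subset[OF T] .
  moreover have "x \<in> T"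
    using xK by (simp add: T_def)
  ultimately have Tx: "T = {x}"
    using neg cT unfolding K_def by blast
  \<comment> \<open>Sura-Bura: a compact component has arbitrarily small relatively clopen
    neighbourhoods, here one of \<open>{x}\<close> inside the open ball.\<close>
  obtain C where C: "openin (top_of_set K) C" "compact C" "T \<subseteq> C" "C \<subseteq> ball x r"
  proof -
    have "locally compact K"
      using cK by (simp add: closed_imp_locally_compact compact_imp_closed)
    moreover have "T \<subseteq> ball x r"
      using Tx r(1) by simp
    ultimately show ?thesis
      using Sura_Bura_clopen_subset[OF _ T cT open_ball] that by metis
  qed
  have "closed (K - C)"
  proof -
    obtain O' where "open O'" "C = K \<inter> O'"
      using C(1) by (auto simp: openin_open)
    then have "K - C = K - O'" by auto
    then show ?thesis
      using cK \<open>open O'\<close> by (simp add: compact_imp_closed closed_Diff)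
  qed
  then have "closed ((K - C) \<union> - ball x r)"
    by auto
  moreover have "closed C" "C \<inter> ((K - C) \<union> - ball x r) = {}"
    using C by (auto intro: compact_imp_closed)
  \<comment> \<open>The closure of \<open>W\<close> will miss \<open>K - C\<close> and stay in the
    ball, so an orbit contained in it lies in \<open>C\<close> and hence already in the open set
    \<open>W\<close>.\<close>
  ultimately obtain W V where WV: "open W" "open V" "C \<subseteq> W" "(K - C) \<union> - ball x r \<subseteq> V" "W \<inter> V = {}"
    using separation_normal by metis
  define W' where "W' = closure W"
  have "W' \<inter> V = {}"
    unfolding W'_def using WV(2,5) open_Int_closure_eq_empty by blast
  then have W': "W' \<inter> (K - C) = {}" "W' \<subseteq> ball x r" "closed W'" "W \<subseteq> W'"
    using WV(4) closure_subset by (auto simp: W'_def)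
  have W'A: "W' \<subseteq> A" and W'r: "W' \<subseteq> cball x r"
    using W'(2) r(2) ball_subset_cball by (blast, blast)
  have cW': "compact W'"
    using W'(3) W'r by (meson bounded_cball bounded_subset compact_eq_bounded_closed)
  define K' where "K' = invariant_part W'"
  have "K' \<subseteq> K"
    unfolding K'_def K_def invariant_part_def using W'r by auto
  then have K'C: "K' \<subseteq> C"
    using W'(1) invariant_part_subset[of W'] by (auto simp: K'_def)
  have K'W: "(F ^^ k) p \<in> W" if "p \<in> K'" for p k
    using funpow_invariant_part[of p W' k] that K'C WV(3) unfolding K'_def by blast
  have "compact K'"
    unfolding K'_def using cW' W'A by (rule invariant_part_compact)
  have xK': "x \<in> K'"
    using C(3) WV(3) W'(4) Tx by (auto simp: K'_def invariant_part_def fix_x)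
  have "open K'"
  proof (rule ccontr)
    assume "\<not> open K'"
    then have "\<not> closed (- K')"
      by (simp add: open_closed)
    then obtain X p where X: "\<And>i. X i \<notin> K'" "X \<longlonglongrightarrow> p" "p \<in> K'"
      unfolding closed_sequential_limits by auto
    have pr: "p \<in> reach k" for k
      using X(3) W'A invariant_part_reach unfolding K'_def by blast
    \<comment> \<open>The first exit time from \<open>W'\<close>. It tends to infinity because the
      orbit of the limit \<open>p\<close> stays in the open set \<open>W\<close>.\<close>
    define m where "m i = (LEAST k. (F ^^ k) (X i) \<notin> W')" for i
    have m: "(F ^^ m i) (X i) \<notin> W'" for i
      unfolding m_def by (rule LeastI_ex) (use X(1)[of i] in \<open>auto simp: K'_def invariant_part_def\<close>)
    have less_m: "(F ^^ k) (X i) \<in> W'" if "k < m i" for i k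
      using that not_less_Least unfolding m_def by blast
    have ev: "\<forall>\<^sub>F i in sequentially. k < m i" for k
    proof -
      have "\<forall>\<^sub>F i in sequentially. (F ^^ j) (X i) \<in> W" for j
        using tendsto_funpow[OF X(2) pr] WV(1) K'W[OF X(3)] topological_tendstoD by blast
      then have "\<forall>\<^sub>F i in sequentially. \<forall>j\<in>{..k}. (F ^^ j) (X i) \<in> W"
        by (intro eventually_ball_finite) auto
      then show ?thesis
      proof (rule eventually_mono)
        fix i assume "\<forall>j\<in>{..k}. (F ^^ j) (X i) \<in> W"
        then have "\<not> m i \<le> k"
          using m[of i] W'(4) by blast
        then show "k < m i" by simp
      qed
    qed
    define q where "q i = (F ^^ (m i - 1)) (X i)" for i
    have ev0: "\<forall>\<^sub>F i in sequentially. q i \<in> W'"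
      using ev[of 0] by (rule eventually_mono) (auto simp: q_def intro: less_m)
    then obtain N where N: "\<And>i. i \<ge> N \<Longrightarrow> q i \<in> W'"
      unfolding eventually_sequentially by blast
    then have "\<forall>i. q (i + N) \<in> W'" by simp
    then obtain l s where l: "l \<in> W'" "strict_mono s" "((\<lambda>i. q (i + N)) \<circ> s) \<longlonglongrightarrow> l"
      using cW'[unfolded compact_eq_seq_compact_metric] by (elim seq_compactE) auto
    define s' where "s' i = s i + N" for i
    have s': "strict_mono s'" "(\<lambda>i. q (s' i)) \<longlonglongrightarrow> l"
      using l by (auto simp: s'_def strict_mono_def o_def)
    interpret bw: pointwise_periodic G F A by (rule swap)
    have "(G ^^ k) l \<in> W'" for k
    proof (induction k rule: less_induct)
      case (less k)
      then have "l \<in> bw.reach k"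
        using W'A by (auto simp: bw.reach_def)
      from bw.tendsto_funpow[OF s'(2) this]
      have lim: "(\<lambda>i. (G ^^ k) (q (s' i))) \<longlonglongrightarrow> (G ^^ k) l" .
      have "\<forall>\<^sub>F i in sequentially. (G ^^ k) (q i) \<in> W'"
        using ev[of "k + 1"]
      proof (rule eventually_mono)
        fix i assume i: "k + 1 < m i"
        have "X i \<in> reach (m i - 1)"
          using less_m W'A by (auto simp: reach_def)
        then have "(G ^^ k) (q i) = (F ^^ (m i - 1 - k)) (X i)"
          unfolding q_def using i by (intro G_funpow_F) auto
        then show "(G ^^ k) (q i) \<in> W'"
          using i by (auto intro: less_m)
      qed
      then have "\<forall>\<^sub>F i in sequentially. (G ^^ k) (q (s' i)) \<in> W'"
        by (rule eventually_subseq[OF s'(1)])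
      then show ?case
        by (rule Lim_in_closed_set[OF W'(3) _ _ lim]) simp
    qed
    then have "l \<in> K'"
      unfolding K'_def by (rule backward_invariant[OF W'A])
    \<comment> \<open>The contradiction: along the subsequence \<open>F (q i)\<close> lies outside
      \<open>W'\<close> by the choice of \<open>m\<close>, but its limit \<open>F l\<close> lies in
      the open set \<open>W\<close>.\<close>
    then have "F l \<in> W" "l \<in> A"
      using K'W[of l 1] l(1) W'A by auto
    moreover have "(\<lambda>i. F (q (s' i))) \<longlonglongrightarrow> F l"
      using tendsto_funpow[OF s'(2), of 1] \<open>l \<in> A\<close> by (simp add: reach_def)
    ultimately have "\<forall>\<^sub>F i in sequentially. F (q (s' i)) \<in> W"
      using WV(1) topological_tendstoD by blast
    moreover have "\<forall>\<^sub>F i in sequentially. F (q (s' i)) = (F ^^ m (s' i)) (X (s' i))"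
      using eventually_subseq[OF s'(1) ev[of 0]]
    proof (rule eventually_mono)
      fix i assume "0 < m (s' i)"
      then obtain j where "m (s' i) = Suc j"
        by (cases "m (s' i)") auto
      then show "F (q (s' i)) = (F ^^ m (s' i)) (X (s' i))"
        by (simp add: q_def)
    qed
    ultimately have "\<forall>\<^sub>F i in sequentially. False"
    proof eventually_elim
      case (elim i)
      then have "(F ^^ m (s' i)) (X (s' i)) \<in> W" by (simp only:)
      then show False
        using m[of "s' i"] W'(4) by blast
    qed
    then show False by simp
  qed
  then show False
    using \<open>compact K'\<close> xK' compact_open by auto
qed

end

section \<open>Complex linear maps of the plane\<close>

abbreviation clin :: "(C2 \<Rightarrow> C2) \<Rightarrow> bool" where
  "clin L \<equiv> Vector_Spaces.linear (*s) (*s) L"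

lemma clinI:
  assumes "\<And>v w. L (v + w) = L v + L w" "\<And>c v. L (c *s v) = c *s L v"
  shows "clin L"
  using assms by unfold_locales (auto simp: vec_eq_iff algebra_simps)

lemma clinD:
  assumes "clin L"
  shows "L (v + w) = L v + L w" "L (c *s v) = c *s L v" "L 0 = 0" "L (- v) = - L v"
    "L (v - w) = L v - L w"
proof -
  interpret Vector_Spaces.linear "(*s)" "(*s)" L by fact
  show "L (v + w) = L v + L w" "L (c *s v) = c *s L v" "L 0 = 0" "L (- v) = - L v"
    "L (v - w) = L v - L w"
    by (rule add scale zero neg diff)+
qed

lemma clin_comp: "clin L \<Longrightarrow> clin M \<Longrightarrow> clin (\<lambda>v. L (M v))"
  by (intro clinI) (simp_all add: clinD)

lemma clin_funpow: "clin L \<Longrightarrow> clin (L ^^ k)"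
  by (induction k) (auto intro!: clinI simp: clinD)

lemma C2_expand: "(v :: C2) = (v $ 1) *s axis 1 1 + (v $ 2) *s axis 2 1"
  by (simp add: vec_eq_iff forall_2 axis_def)

lemma clin_expand: "clin L \<Longrightarrow> L v = (v $ 1) *s L (axis 1 1) + (v $ 2) *s L (axis 2 1)"
  using C2_expand[of v] clinD(1,2) by metis

section \<open>Eigenvalues of a plane map through its trace and determinant\<close>

definition tr2 :: "(C2 \<Rightarrow> C2) \<Rightarrow> complex" where
  "tr2 L = L (axis 1 1) $ 1 + L (axis 2 1) $ 2"

definition det2 :: "(C2 \<Rightarrow> C2) \<Rightarrow> complex" where
  "det2 L = L (axis 1 1) $ 1 * L (axis 2 1) $ 2 - L (axis 2 1) $ 1 * L (axis 1 1) $ 2"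

lemma cayley_hamilton2:
  assumes "clin L"
  shows "L (L v) = tr2 L *s L v - det2 L *s v"
proof -
  define x y where "x = L (axis 1 1)" and "y = L (axis 2 1)"
  have L: "L w $ i = w $ 1 * x $ i + w $ 2 * y $ i" for w i
    by (subst clin_expand[OF assms]) (simp add: x_def y_def)
  show ?thesis
    unfolding vec_eq_iff forall_2 tr2_def det2_def
    by (simp add: L flip: x_def y_def) (simp add: algebra_simps)
qed

text \<open>The roots of the characteristic polynomial with multiplicity; Jordan blocks are
  included.\<close>

definition eigenpair :: "(C2 \<Rightarrow> C2) \<Rightarrow> complex \<Rightarrow> complex \<Rightarrow> bool" where
  "eigenpair L a b \<longleftrightarrow> clin L \<and> tr2 L = a + b \<and> det2 L = a * b"

lemma eigenpair_sym: "eigenpair L a b \<Longrightarrow> eigenpair L b a"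
  by (simp add: eigenpair_def algebra_simps)

text \<open>Cayley-Hamilton in the factored form (L - a)(L - b) = 0: the image of L - b lies in the
  eigenspace of \<open>a\<close>.\<close>

lemma eigenpair_image:
  assumes "eigenpair L a b"
  shows "L (L v - b *s v) = a *s (L v - b *s v)"
  using assms cayley_hamilton2[of L v]
  by (simp add: eigenpair_def clinD vec_eq_iff algebra_simps)

lemma eigenpair_image': "eigenpair L a b \<Longrightarrow> L (L v) - b *s L v = a *s (L v - b *s v)"
  using eigenpair_image[of L a b v] by (simp add: eigenpair_def clinD)

text \<open>Any nonzero vector in the image of L - b is an eigenvector for \<open>a\<close>; if
  there is none, \<open>L\<close> is multiplication by \<open>b\<close> and the trace gives
  \<open>a = b\<close>.\<close>

lemma eigenpair_eigenvalue:
  assumes "eigenpair L a b"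
  shows "eigenvalue L a"
proof (cases "\<exists>v. L v \<noteq> b *s v")
  case True
  then obtain v where "L v - b *s v \<noteq> 0" by auto
  then show ?thesis
    using eigenpair_image[OF assms] unfolding eigenvalue_def by blast
next
  case False
  then have "tr2 L = 2 * b"
    by (simp add: tr2_def axis_def)
  with assms have "a = b"
    by (simp add: eigenpair_def)
  then show ?thesis
    using False unfolding eigenvalue_def by (intro exI[of _ "axis 1 1"]) auto
qed

lemma eigenvalue_eigenpair:
  assumes "clin L" "eigenvalue L a"
  obtains b where "eigenpair L a b"
proof -
  obtain v where v: "v \<noteq> 0" "L v = a *s v"
    using assms(2) by (auto simp: eigenvalue_def)
  have *: "(a * a) *s v = (tr2 L * a - det2 L) *s v"
    using cayley_hamilton2[OF assms(1), of v] v
    by (simp add: clinD[OF assms(1)] vector_smult_assoc vec_eq_iff algebra_simps)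
  then have "det2 L = a * (tr2 L - a)"
  proof -
    obtain i where "v $ i \<noteq> 0"
      using v(1) by (auto simp: vec_eq_iff)
    moreover have "(a * a) * v $ i = (tr2 L * a - det2 L) * v $ i"
      using * by (metis vector_smult_component)
    ultimately have "a * a = tr2 L * a - det2 L"
      using mult_right_cancel by blast
    then show ?thesis
      by (simp add: algebra_simps)
  qed
  then show ?thesis
    using assms(1) that[of "tr2 L - a"] by (simp add: eigenpair_def)
qed

lemma ex_eigenpair:
  assumes "clin L"
  obtains a b where "eigenpair L a b"
proof -
  define s where "s = csqrt ((tr2 L)\<^sup>2 - 4 * det2 L)"
  define a where "a = (tr2 L + s) / 2"
  have "s\<^sup>2 = (tr2 L)\<^sup>2 - 4 * det2 L"
    by (simp add: s_def)
  then have "det2 L = a * (tr2 L - a)"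
    by (simp add: a_def field_simps power2_eq_square)
  then show ?thesis
    using assms that[of a "tr2 L - a"] by (simp add: eigenpair_def)
qed

lemma eigenvalue_cases:
  assumes "eigenpair L a b" "eigenvalue L c"
  shows "c = a \<or> c = b"
proof -
  obtain d where d: "eigenpair L c d"
    using assms eigenvalue_eigenpair unfolding eigenpair_def by metis
  then have "(c - a) * (c - b) = 0"
    using assms(1) unfolding eigenpair_def by algebra
  then show ?thesis by auto
qed

text \<open>The eigenspace of \<open>P\<close> is invariant under \<open>L\<close>, and (L - a)(L -
  b) = 0: either \<open>v\<close> is an eigenvector of \<open>L\<close> for \<open>b\<close>, or
  \<open>L v - b *s v\<close> is one for \<open>a\<close>.\<close>

lemma commuting_eigenvector:
  assumes "clin L" "clin P" "\<And>v. P (L v) = L (P v)" "P v = c *s v" "v \<noteq> 0"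
  shows "\<exists>w a. w \<noteq> 0 \<and> L w = a *s w \<and> P w = c *s w"
proof -
  obtain a b where ab: "eigenpair L a b"
    using ex_eigenpair assms(1) .
  show ?thesis
  proof (cases "L v = b *s v")
    case False
    then have "L v - b *s v \<noteq> 0" by simp
    moreover have "P (L v - b *s v) = c *s (L v - b *s v)"
      using assms(1-4)
      by (simp add: clinD vector_sub_rdistrib vector_ssub_ldistrib vector_smult_assoc mult.commute)
    ultimately show ?thesis
      using eigenpair_image[OF ab] by blast
  qed (use assms in blast)
qed

lemma funpow_eigenvector: "clin L \<Longrightarrow> L v = c *s v \<Longrightarrow> (L ^^ k) v = c ^ k *s v"
  by (induction k) (simp_all add: clinD vector_smult_assoc mult.commute)

lemma eigenvalue_funpow:
  assumes "clin L" "eigenvalue (L ^^ k) c"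
  obtains a where "eigenvalue L a" "c = a ^ k"
proof -
  obtain v where v: "v \<noteq> 0" "(L ^^ k) v = c *s v"
    using assms(2) by (auto simp: eigenvalue_def)
  have "(L ^^ k) (L w) = L ((L ^^ k) w)" for w
    by (simp add: funpow_swap1)
  from commuting_eigenvector[OF assms(1) clin_funpow[OF assms(1)] this v(2,1)]
  obtain w a where w: "w \<noteq> 0" "L w = a *s w" "(L ^^ k) w = c *s w" by blast
  then have "a ^ k *s w = c *s w"
    using funpow_eigenvector[OF assms(1)] by metis
  then have "c = a ^ k"
    using w(1) by simp
  then show ?thesis
    using that w by (auto simp: eigenvalue_def)
qed

text \<open>Turns unipotency into a condition on two functions that depend continuously on the base
  point.\<close>

lemma unipotent_iff:
  assumes "clin L"
  shows "(\<forall>c. eigenvalue L c \<longrightarrow> c = 1) \<longleftrightarrow> tr2 L = 2 \<and> det2 L = 1"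
proof -
  obtain a b where ab: "eigenpair L a b"
    using ex_eigenpair assms .
  have "(\<forall>c. eigenvalue L c \<longrightarrow> c = 1) \<longleftrightarrow> a = 1 \<and> b = 1"
    using eigenvalue_cases[OF ab] eigenpair_eigenvalue[OF ab]
      eigenpair_eigenvalue[OF eigenpair_sym[OF ab]] by blast
  also have "\<dots> \<longleftrightarrow> a + b = 2 \<and> a * b = 1"
  proof
    assume *: "a + b = 2 \<and> a * b = 1"
    then have "b = 2 - a" by (simp add: algebra_simps)
    with * have "(a - 1) * (a - 1) = 0" by (simp add: algebra_simps)
    with * show "a = 1 \<and> b = 1" by auto
  qed auto
  finally show ?thesis
    using ab by (simp add: eigenpair_def)
qed

text \<open>Stability passes to the iterates: a periodic point which is stable for the derivative of the
  first return map cannot be a limit of points of higher period.\<close>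

definition stable :: "(C2 \<Rightarrow> C2) \<Rightarrow> bool" where
  "stable L \<longleftrightarrow> (\<forall>c. eigenvalue L c \<and> root_of_unity c \<longrightarrow> c = 1)"

lemma clin_sum_funpow: "clin L \<Longrightarrow> clin (\<lambda>v. \<Sum>j<k. (L ^^ j) v)"
  by (intro clinI)
     (simp_all add: clinD(1)[OF clin_funpow] clinD(2)[OF clin_funpow] sum.distrib
        vec_eq_iff sum_distrib_left)

text \<open>On a common eigenvector with eigenvalue \<open>a\<close> of \<open>L\<close> the sum
  acts as 1 + a + ... + a^(k-1), which vanishes only if \<open>a\<close> is a \<open>k\<close>-th
  root of unity other than 1. Such sums arise as derivatives of sums of iterates at a periodic
  point.\<close>

lemma stable_sum_funpow:
  assumes L: "clin L" "stable L" and "k \<ge> 1" and v: "(\<Sum>j<k. (L ^^ j) v) = 0"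
  shows "v = 0"
proof (rule ccontr)
  assume "v \<noteq> 0"
  let ?P = "\<lambda>v. \<Sum>j<k. (L ^^ j) v"
  have "?P (L v) = L (?P v)" for v
  proof -
    have "L (\<Sum>j\<in>J. (L ^^ j) v) = (\<Sum>j\<in>J. L ((L ^^ j) v))" if "finite J" for J
      using that by induction (simp_all add: clinD[OF L(1)])
    then show ?thesis by (simp add: funpow_swap1)
  qed
  from commuting_eigenvector[OF L(1) clin_sum_funpow[OF L(1)] this, of v 0] v \<open>v \<noteq> 0\<close>
  obtain w a where w: "w \<noteq> 0" "L w = a *s w" "?P w = 0" by auto
  have "(\<Sum>j<k. a ^ j) *s w = (\<Sum>j<k. a ^ j *s w)"
    by (simp add: vec_eq_iff sum_distrib_right)
  then have "(\<Sum>j<k. a ^ j) *s w = 0"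
    using w(3) by (simp add: funpow_eigenvector[OF L(1) w(2)])
  then have s: "(\<Sum>j<k. a ^ j) = 0"
    using w(1) by simp
  then have "a \<noteq> 1"
    using \<open>k \<ge> 1\<close> by auto
  have "a ^ k = 1"
    using power_diff_1_eq[of a k] s by simp
  then show False
    using \<open>a \<noteq> 1\<close> \<open>k \<ge> 1\<close> w L(2) by (auto simp: stable_def eigenvalue_def root_of_unity_def)
qed

text \<open>\<open>e\<close> is a product of two exponents, each sending one root of the
  characteristic polynomial to 1 if that root is a root of unity. It depends on \<open>t\<close> and
  \<open>d\<close> alone, so it serves all periodic points with the same trace and determinant at
  once.\<close>

lemma ex_stable_funpow:
  "\<exists>e\<ge>1. \<forall>L. clin L \<and> tr2 L = t \<and> det2 L = d \<longrightarrow> stable (L ^^ e)"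
proof (cases "\<exists>L. clin L \<and> tr2 L = t \<and> det2 L = d")
  case True
  then obtain a b where ab: "t = a + b" "d = a * b"
    using ex_eigenpair by (metis eigenpair_def)
  have *: "\<exists>e\<ge>1. root_of_unity c \<longrightarrow> c ^ e = 1" for c
    unfolding root_of_unity_def by blast
  obtain m n where mn: "m \<ge> 1" "n \<ge> 1" "root_of_unity a \<longrightarrow> a ^ m = 1" "root_of_unity b \<longrightarrow> b ^ n = 1"
    using *[of a] *[of b] by blast
  have "stable (L ^^ (m * n))" if L: "clin L" "tr2 L = t" "det2 L = d" for L
    unfolding stable_def
  proof (intro allI impI, elim conjE)
    fix c assume c: "eigenvalue (L ^^ (m * n)) c" "root_of_unity c"
    then obtain x where x: "eigenvalue L x" "c = x ^ (m * n)"
      using eigenvalue_funpow L(1) by blast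
    from c(2) obtain k where "k \<ge> 1" "x ^ (m * n * k) = 1"
      by (auto simp: root_of_unity_def x(2) power_mult)
    then have "root_of_unity x"
      using mn(1,2) unfolding root_of_unity_def by (intro exI[of _ "m * n * k"]) auto
    moreover have "x = a \<or> x = b"
      using eigenvalue_cases[OF _ x(1)] L ab by (auto simp: eigenpair_def)
    ultimately show "c = 1"
      using mn(3,4) x(2) by (metis mult.commute power_mult power_one)
  qed
  moreover have "m * n \<ge> 1" using mn by simp
  ultimately show ?thesis by blast
qed auto

section \<open>Bounds and inverses of complex linear maps\<close>

lemma norm_smult_C2: "norm (c *s (v :: C2)) = norm c * norm v"
proof -
  have "(norm (c *s v))\<^sup>2 = (norm c * norm v)\<^sup>2"
    by (simp add: norm_vec_def L2_set_def sum_2 norm_mult power_mult_distrib algebra_simps)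
  then show ?thesis
    by (simp add: power2_eq_iff_nonneg)
qed

lemma clin_bounded:
  assumes "clin L"
  obtains M where "M > 0" "\<And>v. norm (L v) \<le> M * norm v"
proof
  let ?M = "norm (L (axis 1 1)) + norm (L (axis 2 1)) + 1"
  show "?M > 0" by (simp add: add_nonneg_pos)
  fix v
  have "norm (L v) \<le> norm (v $ 1) * norm (L (axis 1 1)) + norm (v $ 2) * norm (L (axis 2 1))"
    by (subst clin_expand[OF assms]) (metis norm_smult_C2 norm_triangle_ineq)
  also have "\<dots> \<le> norm v * norm (L (axis 1 1)) + norm v * norm (L (axis 2 1))"
    by (intro add_mono mult_right_mono Finite_Cartesian_Product.norm_nth_le) auto
  also have "\<dots> \<le> ?M * norm v" by (simp add: algebra_simps)
  finally show "norm (L v) \<le> ?M * norm v" .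
qed

lemma clin_bounded_linear:
  assumes "clin L"
  shows "bounded_linear L"
proof -
  obtain M where "\<And>v. norm (L v) \<le> M * norm v"
    using clin_bounded[OF assms] by metis
  moreover have "r *\<^sub>R v = complex_of_real r *s v" for r and v :: C2
    unfolding vec_eq_iff vector_scaleR_component vector_smult_component
    by (simp add: scaleR_conv_of_real)
  ultimately show ?thesis
    using clinD[OF assms] by (intro bounded_linear_intro[of _ M]) (auto simp: mult.commute)
qed

lemma clin_inverse:
  assumes "clin L" "\<And>v. L v = 0 \<Longrightarrow> v = 0"
  shows "\<exists>M. clin M \<and> (\<forall>v. L (M v) = v) \<and> (\<forall>v. M (L v) = v)"
proof -
  obtain a b where ab: "eigenpair L a b"
    using ex_eigenpair assms(1) .
  have "a \<noteq> 0" "b \<noteq> 0"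
    using eigenpair_eigenvalue[OF ab] eigenpair_eigenvalue[OF eigenpair_sym[OF ab]] assms(2)
    by (auto simp: eigenvalue_def)
  then have d: "det2 L \<noteq> 0"
    using ab by (simp add: eigenpair_def)
  \<comment> \<open>Cayley-Hamilton solved for the inverse: (tr L - L) / det L.\<close>
  define M where "M v = inverse (det2 L) *s (tr2 L *s v - L v)" for v
  have LL: "det2 L *s v = tr2 L *s L v - L (L v)" for v
    using cayley_hamilton2[OF assms(1), of v] by simp
  have *: "inverse (det2 L) *s (tr2 L *s L v - L (L v)) = v" for v
    using d by (simp add: LL[symmetric] vector_smult_assoc)
  have "clin M"
    unfolding M_def by (intro clinI) (simp_all add: clinD[OF assms(1)] vec_eq_iff algebra_simps)
  moreover have "L (M v) = v" "M (L v) = v" for v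
    using * by (simp_all add: M_def clinD[OF assms(1)])
  ultimately show ?thesis by blast
qed

text \<open>The perturbation \<open>h\<close> stands for the remainder of a differentiable map at a
  fixed point, so the condition passes from the derivative to the map. The line contained in
  \<open>C\<close> supplies starting points arbitrarily close to the fixed point; closedness of
  \<open>C\<close> and continuity of the gauge \<open>f\<close> allow limits to be taken.\<close>

definition expanding_cone ::
    "(C2 \<Rightarrow> C2) \<Rightarrow> C2 set \<Rightarrow> (C2 \<Rightarrow> real) \<Rightarrow> real \<Rightarrow> real \<Rightarrow> real \<Rightarrow> bool" where
  "expanding_cone L C f s e c \<longleftrightarrow> closed C \<and> continuous_on UNIV f \<and> s > 1 \<and> e > 0 \<and> c > 0 \<and>
     (\<exists>v. v \<noteq> 0 \<and> (\<forall>t. t *s v \<in> C)) \<and> (\<forall>v\<in>C. c * norm v \<le> f v) \<and>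
     (\<forall>v h. v \<in> C \<longrightarrow> norm h \<le> e * norm v \<longrightarrow> L v + h \<in> C \<and> s * f v \<le> f (L v + h))"

text \<open>If the eigenvalue \<open>a\<close> dominates \<open>b\<close>, the cone is \<open>\<parallel>L v - a v\<parallel> \<le> \<parallel>L v - b v\<parallel>\<close>: applying \<open>L\<close>
  multiplies the two sides exactly by \<open>\<bar>b\<bar>\<close> and \<open>\<bar>a\<bar>\<close>.\<close>

lemma expanding_cone_dominated:
  assumes ab: "eigenpair L a b" and a: "norm a > 1" "norm a > norm b"
  shows "\<exists>C f s e c. expanding_cone L C f s e c"
proof -
  have L: "clin L" using ab by (simp add: eigenpair_def)
  obtain M where M: "M > 0" "\<And>v. norm (L v) \<le> M * norm v"
    using clin_bounded[OF L] by blast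
  define f g where "f v = norm (L v - b *s v)" and "g v = norm (L v - a *s v)" for v
  have fL: "f (L v) = norm a * f v" for v
    unfolding f_def eigenpair_image'[OF ab] norm_smult_C2 ..
  have gL: "g (L v) = norm b * g v" for v
    unfolding g_def eigenpair_image'[OF eigenpair_sym[OF ab]] norm_smult_C2 ..
  have tri: "norm (L (v + h) - x *s (v + h)) \<le> norm (L v - x *s v) + norm (L h - x *s h)"
    "norm (L v - x *s v) - norm (L h - x *s h) \<le> norm (L (v + h) - x *s (v + h))" for v h x
  proof -
    have "L (v + h) - x *s (v + h) = (L v - x *s v) + (L h - x *s h)"
      by (simp add: clinD[OF L] vector_add_ldistrib)
    then show "norm (L (v + h) - x *s (v + h)) \<le> norm (L v - x *s v) + norm (L h - x *s h)"
      "norm (L v - x *s v) - norm (L h - x *s h) \<le> norm (L (v + h) - x *s (v + h))"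
      by (metis norm_triangle_ineq, metis norm_diff_ineq)
  qed
  define B where "B = M + norm a"
  have B: "B > 0" "f h \<le> B * norm h" "g h \<le> B * norm h" for h
  proof -
    show "B > 0" using M by (simp add: B_def add_pos_nonneg)
    have *: "norm (L h - x *s h) \<le> M * norm h + norm x * norm h" for x
      using norm_triangle_ineq4[of "L h" "x *s h"] M(2)[of h] by (simp add: norm_smult_C2)
    have "norm b * norm h \<le> norm a * norm h"
      using a by (intro mult_right_mono) auto
    then show "f h \<le> B * norm h" "g h \<le> B * norm h"
      using *[of a] *[of b] by (simp_all add: f_def g_def B_def algebra_simps)
  qed
  \<comment> \<open>The rate \<open>s\<close> is the midpoint between \<open>m\<close> and
    \<open>norm a\<close>. On the cone \<open>c * norm v\<close> is a lower bound for
    \<open>f v\<close>, and \<open>e\<close> is chosen so that a perturbation changes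
    \<open>f\<close> and \<open>g\<close> by at most half the gap times \<open>f v\<close>: then
    \<open>f\<close> still grows by the factor \<open>s\<close>, while \<open>g\<close> of the image
    is at most \<open>s * f v\<close>.\<close>
  define m where "m = max 1 (norm b)"
  define s where "s = (norm a + m) / 2"
  define c where "c = norm (a - b) / 2"
  define e where "e = (norm a - m) / 2 * c / B"
  have m: "1 \<le> m" "norm b \<le> m" "m < norm a"
    using a by (auto simp: m_def)
  have "c > 0"
    using a by (auto simp: c_def)
  have "s > 1" "e > 0"
    using m \<open>c > 0\<close> B(1) by (auto simp: s_def e_def)
  define C where "C = {v. g v \<le> f v}"
  have cont: "continuous_on UNIV L"
    using clin_bounded_linear[OF L] linear_continuous_on by blast
  have cont_sm: "continuous_on UNIV (\<lambda>v::C2. x *s v)" for x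
    by (intro linear_continuous_on clin_bounded_linear clinI)
       (simp_all add: vector_add_ldistrib vector_smult_assoc mult.commute)
  have "continuous_on UNIV f" "continuous_on UNIV g"
    unfolding f_def g_def by (intro continuous_intros cont cont_sm)+
  moreover from this have "closed C"
    unfolding C_def by (intro closed_Collect_le)
  moreover have cf: "c * norm v \<le> f v" if "v \<in> C" for v
  proof -
    have "(a - b) *s v = (L v - b *s v) - (L v - a *s v)"
      by (simp add: vector_sub_rdistrib)
    then have "norm (a - b) * norm v \<le> f v + g v"
      unfolding f_def g_def by (metis norm_smult_C2 norm_triangle_ineq4)
    then show ?thesis
      using that by (simp add: C_def c_def)
  qed
  moreover have "L v + h \<in> C \<and> s * f v \<le> f (L v + h)" if v: "v \<in> C" and h: "norm h \<le> e * norm v" for v h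
  proof -
    have "B * norm h \<le> B * (e * norm v)"
      using h B(1) by simp
    also have "\<dots> = (norm a - m) / 2 * (c * norm v)"
      using B(1) by (simp add: e_def)
    also have "\<dots> \<le> (norm a - m) / 2 * f v"
      using m cf[OF v] by (intro mult_left_mono) auto
    finally have Bh: "B * norm h \<le> (norm a - m) / 2 * f v" .
    have "norm a * f v - B * norm h \<le> f (L v + h)"
      using tri(2)[of "L v" b h] B(2)[of h] fL[of v] by (simp add: f_def)
    with Bh have 1: "s * f v \<le> f (L v + h)"
      by (simp add: s_def field_simps)
    have "norm b * g v \<le> m * f v"
      using m v by (intro mult_mono) (auto simp: C_def g_def)
    then have "g (L v + h) \<le> m * f v + B * norm h"
      using tri(1)[of "L v" h a] B(3)[of h] gL[of v] by (simp add: g_def)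
    with Bh have "g (L v + h) \<le> s * f v"
      by (simp add: s_def field_simps)
    with 1 show ?thesis by (simp add: C_def)
  qed
  moreover obtain v where v: "v \<noteq> 0" "L v = a *s v"
    using eigenpair_eigenvalue[OF ab] by (auto simp: eigenvalue_def)
  then have "t *s v \<in> C" for t
    by (simp add: C_def f_def g_def clinD[OF L] vector_smult_assoc mult.commute)
  ultimately have "expanding_cone L C f s e c"
    using \<open>s > 1\<close> \<open>e > 0\<close> \<open>c > 0\<close> v(1)
    unfolding expanding_cone_def by meson
  then show ?thesis by blast
qed

text \<open>If both eigenvalues are large, \<open>L\<close> expands everything in the norm \<open>\<parallel>v\<parallel> + K \<parallel>L v - a v\<parallel>\<close> with
  large \<open>K\<close>; the second term absorbs the nilpotent part of \<open>L\<close>.\<close>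

lemma expanding_cone_UNIV:
  assumes ab: "eigenpair L a b" and a: "norm a > 1" "norm b > 1"
  shows "\<exists>C f s e c. expanding_cone L C f s e c"
proof -
  have L: "clin L" using ab by (simp add: eigenpair_def)
  obtain M where M: "M > 0" "\<And>v. norm (L v) \<le> M * norm v"
    using clin_bounded[OF L] by blast
  define w where "w v = L v - a *s v" for v
  have wL: "w (L v) = b *s w v" for v
    unfolding w_def using eigenpair_image'[OF eigenpair_sym[OF ab]] .
  have w_add: "w (v + h) = w v + w h" for v h
    by (simp add: w_def clinD[OF L] vector_add_ldistrib)
  have w_le: "norm (w v) \<le> (M + norm a) * norm v" for v
    using norm_triangle_ineq4[of "L v" "a *s v"] M(2)[of v]
    by (simp add: w_def norm_smult_C2 algebra_simps)
  define m where "m = min (norm a) (norm b)"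
  define s where "s = (1 + m) / 2"
  \<comment> \<open>The lower bound for \<open>norm (L v)\<close> loses \<open>norm (w v)\<close>.
    The second term of the norm grows by \<open>m\<close> although only the factor \<open>s\<close>
    is required, and \<open>K\<close> makes this surplus equal to the loss.\<close>
  define K where "K = 1 / (m - s)"
  have m: "m > 1" "m \<le> norm a" "m \<le> norm b"
    using a by (auto simp: m_def)
  have s: "1 < s" "s < m" using m by (auto simp: s_def)
  have K: "K > 0" "K * (m - s) = 1" using s by (auto simp: K_def)
  define f where "f v = norm v + K * norm (w v)" for v
  define D where "D = 1 + K * (M + norm a)"
  have D: "D > 0" "f v \<le> D * norm v" for v
  proof -
    show "D > 0" using K M by (simp add: D_def add_pos_nonneg)
    have "K * norm (w v) \<le> K * ((M + norm a) * norm v)"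
      using w_le[of v] K by simp
    then show "f v \<le> D * norm v"
      by (simp add: f_def D_def algebra_simps)
  qed
  have fL: "s * f v \<le> f (L v)" for v
  proof -
    have "L v = a *s v + w v" by (simp add: w_def)
    then have "norm a * norm v - norm (w v) \<le> norm (L v)"
      by (metis norm_diff_ineq norm_smult_C2)
    moreover have "s * norm v \<le> norm a * norm v"
      using s m by (intro mult_right_mono) auto
    moreover have "K * norm (w (L v)) = norm b * (K * norm (w v))"
      by (simp add: wL norm_smult_C2)
    moreover have "m * (K * norm (w v)) \<le> norm b * (K * norm (w v))"
      using m K by (intro mult_right_mono) auto
    moreover have "m * (K * norm (w v)) = s * (K * norm (w v)) + norm (w v)"
    proof -
      have "m * (K * norm (w v)) = s * (K * norm (w v)) + (K * (m - s)) * norm (w v)"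
        by (simp only: algebra_simps)
      then show ?thesis by (simp only: K(2) mult_1)
    qed
    ultimately show ?thesis
      unfolding f_def distrib_left by linarith
  qed
  have cont: "continuous_on UNIV L"
    using clin_bounded_linear[OF L] linear_continuous_on by blast
  have cont_sm: "continuous_on UNIV (\<lambda>v::C2. x *s v)" for x
    by (intro linear_continuous_on clin_bounded_linear clinI)
       (simp_all add: vector_add_ldistrib vector_smult_assoc mult.commute)
  have "continuous_on UNIV f"
    unfolding f_def w_def by (intro continuous_intros cont cont_sm)
  \<comment> \<open>Perturbations of this size cost at most \<open>(s - 1) / 2 * f v\<close>, which
    leaves the rate \<open>(1 + s) / 2 > 1\<close>.\<close>
  define e where "e = (s - 1) / 2 / D"
  have "e > 0" using s D by (simp add: e_def)
  have f_ge: "norm v \<le> f v" for v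
    using K by (simp add: f_def)
  have "(1 + s) / 2 * f v \<le> f (L v + h)" if h: "norm h \<le> e * norm v" for v h
  proof -
    have "D * norm h \<le> D * (e * norm v)"
      using h D(1) by simp
    also have "\<dots> = (s - 1) / 2 * norm v"
      using D(1) by (simp add: e_def)
    also have "\<dots> \<le> (s - 1) / 2 * f v"
      using s f_ge by (intro mult_left_mono) auto
    finally have "f h \<le> (s - 1) / 2 * f v"
      using D(2)[of h] by linarith
    moreover have "f (L v) - f h \<le> f (L v + h)"
    proof -
      have "norm (L v) - norm h \<le> norm (L v + h)"
        "K * norm (w (L v)) - K * norm (w h) \<le> K * norm (w (L v + h))"
        using norm_diff_ineq[of "w (L v)" "w h"] K
        by (simp_all add: norm_diff_ineq w_add flip: right_diff_distrib)
      then show ?thesis by (simp add: f_def)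
    qed
    ultimately show ?thesis
      using fL[of v] by (simp add: field_simps)
  qed
  moreover have "(1 + s) / 2 > 1" using s by simp
  moreover have "axis 1 1 \<noteq> (0 :: C2)" by (simp add: axis_eq_0_iff)
  ultimately show ?thesis
    using \<open>e > 0\<close> f_ge \<open>continuous_on UNIV f\<close>
    by (intro exI[of _ UNIV] exI[of _ f] exI[of _ "(1 + s) / 2"] exI[of _ e] exI[of _ 1])
       (auto simp: expanding_cone_def)
qed

lemma ex_expanding_cone:
  assumes "clin L" "eigenvalue L a" "norm a > 1"
  shows "\<exists>C f s e c. expanding_cone L C f s e c"
proof -
  obtain b where ab: "eigenpair L a b"
    by (rule eigenvalue_eigenpair[OF assms(1,2)])
  show ?thesis
  proof (cases "norm b < norm a")
    case True
    from expanding_cone_dominated[OF ab assms(3) this] show ?thesis .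
  next
    case False
    with assms(3) have "norm b > 1" by simp
    from expanding_cone_UNIV[OF ab assms(3) this] show ?thesis .
  qed
qed

section \<open>Holomorphic maps in two variables\<close>

abbreviation D :: "(C2 \<Rightarrow> C2) \<Rightarrow> C2 \<Rightarrow> C2 \<Rightarrow> C2" where
  "D H z \<equiv> frechet_derivative H (at z)"

lemma D_unique: "(H has_derivative L) (at z) \<Longrightarrow> D H z = L"
  using frechet_derivative_at by force

lemma holomorphic_C2I:
  assumes "\<And>z. z \<in> S \<Longrightarrow> \<exists>L. (H has_derivative L) (at z) \<and> clin L"
  shows "holomorphic_C2 H S"
  using assms by (simp add: holomorphic_C2_def)

lemma holomorphic_C2D:
  assumes "holomorphic_C2 H S" "z \<in> S"
  shows "(H has_derivative D H z) (at z)" "clin (D H z)"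
  using assms D_unique unfolding holomorphic_C2_def by metis+

lemma holomorphic_C2_subset: "holomorphic_C2 H S \<Longrightarrow> T \<subseteq> S \<Longrightarrow> holomorphic_C2 H T"
  by (auto simp: holomorphic_C2_def)

lemma holomorphic_C2_continuous_on: "holomorphic_C2 H S \<Longrightarrow> continuous_on S H"
  by (meson holomorphic_C2D(1) continuous_at_imp_continuous_on has_derivative_continuous)

lemma D_comp:
  assumes "holomorphic_C2 H S" "holomorphic_C2 K T" "z \<in> S" "H z \<in> T"
  shows "((\<lambda>z. K (H z)) has_derivative (\<lambda>v. D K (H z) (D H z v))) (at z)"
  using diff_chain_at[OF holomorphic_C2D(1)[OF assms(1,3)] holomorphic_C2D(1)[OF assms(2,4)]]
  by (simp add: o_def)

lemma holomorphic_C2_comp: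
  assumes "holomorphic_C2 H S" "holomorphic_C2 K T" "H ` S \<subseteq> T"
  shows "holomorphic_C2 (\<lambda>z. K (H z)) S"
proof (rule holomorphic_C2I)
  fix z assume z: "z \<in> S"
  then have "H z \<in> T" using assms(3) by blast
  from D_comp[OF assms(1,2) z this] show "\<exists>L. ((\<lambda>z. K (H z)) has_derivative L) (at z) \<and> clin L"
    using clin_comp holomorphic_C2D(2) assms(1,2) z \<open>H z \<in> T\<close> by blast
qed

lemma holomorphic_C2_clin: "clin L \<Longrightarrow> holomorphic_C2 L S"
  using bounded_linear.has_derivative[OF clin_bounded_linear has_derivative_ident]
  by (intro holomorphic_C2I exI[of _ L]) simp

lemma holomorphic_C2_id: "holomorphic_C2 (\<lambda>z. z) S"
  by (intro holomorphic_C2_clin clinI) simp_all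

lemma holomorphic_C2_add:
  assumes "holomorphic_C2 H S" "holomorphic_C2 K S"
  shows "holomorphic_C2 (\<lambda>z. H z + K z) S"
proof (rule holomorphic_C2I)
  fix z assume z: "z \<in> S"
  note * = holomorphic_C2D[OF assms(1) z] holomorphic_C2D[OF assms(2) z]
  show "\<exists>L. ((\<lambda>z. H z + K z) has_derivative L) (at z) \<and> clin L"
    using has_derivative_add[OF *(1,3)] *(2,4)
    by (intro exI[of _ "\<lambda>v. D H z v + D K z v"] conjI clinI) (simp_all add: clinD vector_add_ldistrib)
qed

lemma holomorphic_C2_diff:
  assumes "holomorphic_C2 H S" "holomorphic_C2 K S"
  shows "holomorphic_C2 (\<lambda>z. H z - K z) S"
proof (rule holomorphic_C2I)
  fix z assume z: "z \<in> S"
  note * = holomorphic_C2D[OF assms(1) z] holomorphic_C2D[OF assms(2) z]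
  show "\<exists>L. ((\<lambda>z. H z - K z) has_derivative L) (at z) \<and> clin L"
    using has_derivative_diff[OF *(1,3)] *(2,4)
    by (intro exI[of _ "\<lambda>v. D H z v - D K z v"] conjI clinI) (simp_all add: clinD vector_ssub_ldistrib)
qed

lemma holomorphic_C2_const: "holomorphic_C2 (\<lambda>z. c) S"
  by (intro holomorphic_C2I exI[of _ "\<lambda>v. 0"] conjI clinI) auto

lemma holomorphic_C2_sum:
  "finite I \<Longrightarrow> (\<And>i. i \<in> I \<Longrightarrow> holomorphic_C2 (H i) S) \<Longrightarrow> holomorphic_C2 (\<lambda>z. \<Sum>i\<in>I. H i z) S"
  by (induction rule: finite_induct) (auto intro: holomorphic_C2_add holomorphic_C2_const)

lemma bounded_linear_smult_left: "bounded_linear (\<lambda>h. h *s (w :: C2))"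
proof (rule bounded_linear_intro[of _ "norm w"])
  show "(r *\<^sub>R h) *s w = r *\<^sub>R (h *s w)" for r h
    by (simp add: vec_eq_iff)
qed (simp_all add: norm_smult_C2 vector_sadd_rdistrib)

section \<open>Restriction of holomorphic maps to complex lines and curves, and regularity of the
  derivative\<close>

lemma has_derivative_line: "((\<lambda>h. z + h *s v) has_derivative (\<lambda>h. h *s (v :: C2))) (at t)"
  by (auto intro!: derivative_eq_intros bounded_linear.has_derivative[OF bounded_linear_smult_left])

lemma curve_comp:
  assumes "holomorphic_C2 H S" "\<gamma> t \<in> S" "(\<gamma> has_derivative (\<lambda>h. h *s w)) (at t)"
  shows "((\<lambda>t. H (\<gamma> t)) has_derivative (\<lambda>h. h *s D H (\<gamma> t) w)) (at t)"
  using diff_chain_at[OF assms(3) holomorphic_C2D(1)[OF assms(1,2)]]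
  by (simp add: o_def clinD[OF holomorphic_C2D(2)[OF assms(1,2)]])

lemma curve_nth:
  fixes \<gamma> :: "complex \<Rightarrow> C2"
  assumes "(\<gamma> has_derivative (\<lambda>h. h *s w)) (at t)"
  shows "((\<lambda>t. \<gamma> t $ i) has_field_derivative w $ i) (at t)"
  using bounded_linear.has_derivative[OF bounded_linear_vec_nth assms, of i]
  by (simp add: has_field_derivative_def mult_commute_abs)

lemma has_field_derivative_slice:
  assumes "holomorphic_C2 H S" "z + t *s v \<in> S"
  shows "((\<lambda>t. H (z + t *s v) $ i) has_field_derivative D H (z + t *s v) v $ i) (at t)"
  using curve_nth[OF curve_comp[OF assms has_derivative_line]] .

text \<open>Holomorphy is only pointwise differentiability here. The Cauchy inequality, applied to
  the difference of \<open>H\<close> on two parallel complex discs in direction \<open>v\<close>,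
  bounds the difference of the derivatives by that of the values, and \<open>H\<close> is uniformly
  continuous on compact balls.\<close>

lemma continuous_on_D:
  assumes H: "holomorphic_C2 H S" and S: "open S"
  shows "continuous_on S (\<lambda>z. D H z v)"
proof -
  have "\<exists>d>0. \<forall>z\<in>S. dist z a < d \<longrightarrow> dist (D H z v $ i) (D H a v $ i) < e"
    if a: "a \<in> S" and "e > 0" for a e i
  proof -
    obtain r where r: "r > 0" "cball a r \<subseteq> S"
      using S a open_contains_cball by blast
    have "uniformly_continuous_on (cball a r) H"
      using holomorphic_C2_continuous_on[OF H] r(2)
      by (intro compact_uniformly_continuous) (auto intro: continuous_on_subset)
    \<comment> \<open>Discs of this radius in direction \<open>v\<close> have extent at most
      \<open>r / 2\<close>; the added 1 covers \<open>v = 0\<close>.\<close>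
    define \<rho> where "\<rho> = r / 2 / (norm v + 1)"
    have \<rho>: "\<rho> > 0" "\<rho> * norm v \<le> r / 2"
      using r(1) by (auto simp: \<rho>_def field_simps add_pos_nonneg)
    obtain d where d: "d > 0" and
      ucont: "\<And>x y. x \<in> cball a r \<Longrightarrow> y \<in> cball a r \<Longrightarrow> dist y x < d \<Longrightarrow> dist (H y) (H x) < e / 2 * \<rho>"
      using \<open>uniformly_continuous_on (cball a r) H\<close> \<open>e > 0\<close> \<rho>(1)
      unfolding uniformly_continuous_on_def by (metis half_gt_zero mult_pos_pos)
    have "dist (D H z v $ i) (D H a v $ i) < e" if z: "dist z a < min d (r / 2)" for z
    proof -
      have "norm (t *s v) \<le> r / 2" if "norm t \<le> \<rho>" for t
      proof -
        have "norm t * norm v \<le> \<rho> * norm v"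
          using that by (rule mult_right_mono) simp
        then show ?thesis using \<rho>(2) by (simp add: norm_smult_C2)
      qed
      then have in_r: "z + t *s v \<in> cball a r" "a + t *s v \<in> cball a r" if "norm t \<le> \<rho>" for t
        using z that r(1) norm_triangle_ineq[of "z - a" "t *s v"]
        by (force simp: dist_norm norm_minus_commute algebra_simps)+
      define g where "g t = H (z + t *s v) $ i - H (a + t *s v) $ i" for t
      have g: "(g has_field_derivative D H (z + t *s v) v $ i - D H (a + t *s v) v $ i) (at t)"
        if "norm t \<le> \<rho>" for t
        unfolding g_def using in_r[OF that] r(2)
        by (intro DERIV_diff has_field_derivative_slice[OF H]) auto
      have "norm ((deriv ^^ 1) g 0) \<le> fact 1 * (e / 2 * \<rho>) / \<rho> ^ 1"
      proof (rule Cauchy_inequality)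
        show "g holomorphic_on ball 0 \<rho>"
        proof (rule holomorphic_onI)
          fix t :: complex assume "t \<in> ball 0 \<rho>"
          then have "norm t \<le> \<rho>" by simp
          from g[OF this] show "g field_differentiable at t within ball 0 \<rho>"
            using field_differentiable_at_within field_differentiable_def by blast
        qed
        show "continuous_on (cball 0 \<rho>) g"
          using g by (intro continuous_at_imp_continuous_on ballI DERIV_isCont) auto
        fix t :: complex assume "norm (0 - t) = \<rho>"
        then have "dist (H (z + t *s v)) (H (a + t *s v)) < e / 2 * \<rho>"
          using z in_r[of t] by (intro ucont) (auto simp: dist_norm)
        moreover have "norm (g t) \<le> dist (H (z + t *s v)) (H (a + t *s v))"
          unfolding g_def dist_norm
          using Finite_Cartesian_Product.norm_nth_le[of "H (z + t *s v) - H (a + t *s v)" i] by simp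
        ultimately show "norm (g t) \<le> e / 2 * \<rho>" by simp
      qed (use \<rho> in auto)
      moreover have "deriv g 0 = D H z v $ i - D H a v $ i"
        using DERIV_imp_deriv[OF g[of 0]] \<rho>(1) by simp
      ultimately show ?thesis
        using \<rho>(1) \<open>e > 0\<close> by (simp add: dist_norm)
    qed
    then show ?thesis
      using d r(1) by (intro exI[of _ "min d (r / 2)"]) auto
  qed
  then have "continuous_on S (\<lambda>z. D H z v $ i)" for i
    unfolding continuous_on_iff by blast
  then have "continuous_on S (\<lambda>z. \<chi> i. D H z v $ i)"
    by (intro continuous_on_vec_lambda)
  then show ?thesis by simp
qed

lemma continuous_on_tr2_det2:
  assumes "holomorphic_C2 H S" "open S"
  shows "continuous_on S (\<lambda>z. tr2 (D H z))" "continuous_on S (\<lambda>z. det2 (D H z))"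
  unfolding tr2_def det2_def
  by (intro continuous_intros continuous_on_D[OF assms])+

lemma onorm_D_small:
  assumes H: "holomorphic_C2 H S" and S: "open S" and a: "a \<in> S" and e: "e > 0"
  shows "\<exists>d>0. \<forall>z. dist a z < d \<longrightarrow> onorm (\<lambda>v. D H z v - D H a v) < e"
proof -
  have "\<exists>d>0. \<forall>z\<in>S. dist z a < d \<longrightarrow> norm (D H z v - D H a v) < e / 3" for v
    using continuous_on_D[OF H S, of v] a e unfolding continuous_on_iff dist_norm
    by (metis zero_less_divide_iff zero_less_numeral)
  then obtain d where d: "\<And>v. d v > 0" "\<And>v z. z \<in> S \<Longrightarrow> dist z a < d v \<Longrightarrow> norm (D H z v - D H a v) < e / 3"
    by metis
  obtain r where r: "r > 0" "ball a r \<subseteq> S"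
    using S a open_contains_ball by blast
  define \<delta> where "\<delta> = min r (min (d (axis 1 1)) (d (axis 2 1)))"
  have "onorm (\<lambda>v. D H z v - D H a v) < e" if z: "dist a z < \<delta>" for z
  proof -
    let ?L = "\<lambda>v. D H z v - D H a v"
    have zS: "z \<in> S"
      using z r by (auto simp: \<delta>_def)
    have L: "clin ?L"
      by (intro clinI)
         (simp_all add: clinD[OF holomorphic_C2D(2)[OF H zS]] clinD[OF holomorphic_C2D(2)[OF H a]]
            vector_ssub_ldistrib)
    have small: "norm (?L (axis 1 1)) < e / 3" "norm (?L (axis 2 1)) < e / 3"
      using z zS d(2)[of z "axis 1 1"] d(2)[of z "axis 2 1"] by (auto simp: \<delta>_def dist_commute)
    have "norm (?L v) \<le> 2 * e / 3 * norm v" for v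
    proof -
      have "norm (?L v) = norm ((v $ 1) *s ?L (axis 1 1) + (v $ 2) *s ?L (axis 2 1))"
        using clin_expand[OF L, of v] by simp
      also have "\<dots> \<le> norm (v $ 1) * norm (?L (axis 1 1)) + norm (v $ 2) * norm (?L (axis 2 1))"
        by (metis norm_smult_C2 norm_triangle_ineq)
      also have "\<dots> \<le> norm v * (e / 3) + norm v * (e / 3)"
        by (intro add_mono mult_mono Finite_Cartesian_Product.norm_nth_le less_imp_le[OF small(1)]
            less_imp_le[OF small(2)]) auto
      finally show ?thesis by simp
    qed
    then have "onorm ?L \<le> 2 * e / 3"
      using e by (intro onorm_bound) auto
    then show ?thesis using e by simp
  qed
  then show ?thesis
    using d(1) r(1) by (intro exI[of _ \<delta>]) (auto simp: \<delta>_def)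
qed

lemma holomorphic_C2_locally_inj:
  assumes H: "holomorphic_C2 H S" and S: "open S" and a: "a \<in> S"
    and inj: "\<And>v. D H a v = 0 \<Longrightarrow> v = 0"
  obtains r where "r > 0" "ball a r \<subseteq> S" "inj_on H (ball a r)"
proof -
  obtain M where M: "clin M" "\<And>v. D H a (M v) = v" "\<And>v. M (D H a v) = v"
    using clin_inverse[OF holomorphic_C2D(2)[OF H a] inj] by blast
  show ?thesis
  proof (rule has_derivative_locally_injective[OF a S, of M "\<lambda>z. D H z" H])
    show "M \<circ> D H a = id"
      using M(3) by auto
    show "\<exists>d>0. \<forall>x. dist a x < d \<longrightarrow> onorm (\<lambda>v. D H x v - D H a v) < e" if "e > 0" for e
      using onorm_D_small[OF H S a that] .
    show "thesis" if "r > 0" "ball a r \<subseteq> S" "inj_on H (ball a r)" for r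
      using that by (rule \<open>\<And>r. r > 0 \<Longrightarrow> ball a r \<subseteq> S \<Longrightarrow> inj_on H (ball a r) \<Longrightarrow> thesis\<close>)
  qed (fact clin_bounded_linear[OF M(1)] holomorphic_C2D(1)[OF H])+
qed

lemma det2_nonzero_iff:
  assumes "clin L"
  shows "det2 L \<noteq> 0 \<longleftrightarrow> (\<forall>v. L v = 0 \<longrightarrow> v = 0)"
proof
  assume "\<forall>v. L v = 0 \<longrightarrow> v = 0"
  moreover obtain a b where ab: "eigenpair L a b"
    using ex_eigenpair assms .
  ultimately have "a \<noteq> 0" "b \<noteq> 0"
    using eigenpair_eigenvalue[OF ab] eigenpair_eigenvalue[OF eigenpair_sym[OF ab]]
    by (auto simp: eigenvalue_def)
  then show "det2 L \<noteq> 0" using ab by (simp add: eigenpair_def)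
next
  assume d: "det2 L \<noteq> 0"
  have "v = 0" if "L v = 0" for v
  proof -
    have "det2 L *s v = 0"
      using cayley_hamilton2[OF assms, of v] that by (simp add: clinD[OF assms])
    then show ?thesis using d by simp
  qed
  then show "\<forall>v. L v = 0 \<longrightarrow> v = 0" by blast
qed

text \<open>The ball is shrunk until \<open>H\<close> is injective and its derivative invertible at
  every point, not just at \<open>a\<close>; the inverse is then complex differentiable on the whole
  image, which is open by invariance of domain.\<close>

lemma holomorphic_C2_local_inverse:
  assumes H: "holomorphic_C2 H S" and S: "open S" and a: "a \<in> S"
    and inj: "\<And>v. D H a v = 0 \<Longrightarrow> v = 0"
  obtains r K where "r > 0" "ball a r \<subseteq> S" "open (H ` ball a r)" "holomorphic_C2 K (H ` ball a r)"
    "\<And>z. z \<in> ball a r \<Longrightarrow> K (H z) = z"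
proof -
  obtain r1 where r1: "r1 > 0" "ball a r1 \<subseteq> S" "inj_on H (ball a r1)"
    using holomorphic_C2_locally_inj[OF H S a inj] by blast
  have "det2 (D H a) \<noteq> 0"
    using det2_nonzero_iff[OF holomorphic_C2D(2)[OF H a]] inj by blast
  then have "a \<in> S \<inter> (\<lambda>z. det2 (D H z)) -` (- {0})"
    using a by simp
  moreover have "open (S \<inter> (\<lambda>z. det2 (D H z)) -` (- {0}))"
    by (rule continuous_open_preimage[OF continuous_on_tr2_det2(2)[OF H S] S]) auto
  ultimately obtain r2 where r2: "r2 > 0" "ball a r2 \<subseteq> S \<inter> (\<lambda>z. det2 (D H z)) -` (- {0})"
    using open_contains_ball by blast
  define r where "r = min r1 r2"
  define B where "B = ball a r"
  have B: "open B" "B \<subseteq> S" "inj_on H B" "\<And>z. z \<in> B \<Longrightarrow> det2 (D H z) \<noteq> 0"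
    using r1 r2(2) by (auto simp: B_def r_def intro: inj_on_subset)
  have contB: "continuous_on B H"
    using holomorphic_C2_continuous_on[OF H] B(2) continuous_on_subset by blast
  define K where "K = inv_into B H"
  have KH: "K (H z) = z" if "z \<in> B" for z
    using that B(3) by (simp add: K_def)
  have "holomorphic_C2 K (H ` B)"
  proof (rule holomorphic_C2I)
    fix y assume "y \<in> H ` B"
    then obtain z where z: "z \<in> B" "y = H z" by blast
    then have DH: "(H has_derivative D H z) (at z)" "clin (D H z)"
      using holomorphic_C2D[OF H] B(2) by auto
    have "v = 0" if "D H z v = 0" for v
      using det2_nonzero_iff[OF DH(2)] B(4)[OF z(1)] that by blast
    then obtain M where M: "clin M" "\<And>v. D H z (M v) = v"
      using clin_inverse[OF DH(2)] by blast
    then have "D H z \<circ> M = id" by auto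
    from has_derivative_inverse_strong[OF B(1) z(1) contB KH DH(1) this]
    show "\<exists>L. (K has_derivative L) (at y) \<and> clin L"
      using M(1) z(2) by blast
  qed
  moreover have "open (H ` B)"
    using invariance_of_domain[OF contB B(1,3)] .
  ultimately show ?thesis
    using that[of r K] KH r1(1) r2(1) B(2) unfolding B_def r_def by auto
qed

text \<open>The difference quotients of \<open>H\<close> in direction \<open>v\<close> are
  holomorphic along the curve and converge locally uniformly to the derivative, so the limit is
  holomorphic. This yields holomorphy of the determinant along a curve of fixed points.\<close>

lemma holomorphic_on_D_curve:
  assumes H: "holomorphic_C2 H S" and S: "open S" and T: "open T"
    and \<gamma>: "\<And>t. t \<in> T \<Longrightarrow> \<exists>w. (\<gamma> has_derivative (\<lambda>h. h *s w)) (at t)" "\<gamma> ` T \<subseteq> S"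
  shows "(\<lambda>t. D H (\<gamma> t) v $ i) holomorphic_on T"
proof -
  have holH: "(\<lambda>t. H (\<gamma> t + c) $ i) holomorphic_on U"
    if U: "open U" "U \<subseteq> T" "\<And>t. t \<in> U \<Longrightarrow> \<gamma> t + c \<in> S" for U c
  proof (rule holomorphic_onI)
    fix t assume t: "t \<in> U"
    obtain w where w: "(\<gamma> has_derivative (\<lambda>h. h *s w)) (at t)"
      using \<gamma>(1) U t by blast
    have "((\<lambda>t. \<gamma> t + c) has_derivative (\<lambda>h. h *s w)) (at t)"
      using has_derivative_add_const[OF w] .
    from curve_nth[OF curve_comp[OF H U(3)[OF t] this], of i]
    show "(\<lambda>t. H (\<gamma> t + c) $ i) field_differentiable at t within U"
      by (meson field_differentiable_at_within field_differentiable_def)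
  qed
  have cont\<gamma>: "continuous_on T \<gamma>"
    using \<gamma>(1) by (meson continuous_at_imp_continuous_on has_derivative_continuous)
  have local: "\<exists>e>0. (\<lambda>t. D H (\<gamma> t) v $ i) holomorphic_on ball t0 e" if t0: "t0 \<in> T" for t0
  proof -
    have "\<gamma> t0 \<in> S" using \<gamma>(2) t0 by blast
    then obtain r0 where r0: "r0 > 0" "cball (\<gamma> t0) r0 \<subseteq> S"
      using S open_contains_cball by blast
    define r where "r = r0 / 2"
    have r: "r > 0" "cball (\<gamma> t0) (2 * r) \<subseteq> S"
      using r0 by (simp_all add: r_def)
    have "open (T \<inter> \<gamma> -` ball (\<gamma> t0) r)"
      by (rule continuous_open_preimage[OF cont\<gamma> T open_ball])
    then obtain e where e: "e > 0" "ball t0 e \<subseteq> T" "\<gamma> ` ball t0 e \<subseteq> ball (\<gamma> t0) r"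
      using t0 r(1) by (force simp: open_contains_ball)
    define \<rho> where "\<rho> = r / (norm v + 1)"
    have \<rho>: "\<rho> > 0" "\<rho> * norm v \<le> r"
      using r(1) by (auto simp: \<rho>_def field_simps add_pos_nonneg)
    define q where "q n = complex_of_real (\<rho> * inverse (real (Suc n)))" for n :: nat
    have nq: "norm (q n) = \<rho> * inverse (real (Suc n))" for n
      unfolding q_def norm_of_real using \<rho>(1) by (intro abs_of_nonneg mult_nonneg_nonneg) auto
    have q: "q n \<noteq> 0" "norm (q n) * norm v \<le> r" for n
    proof -
      show "q n \<noteq> 0" using \<rho>(1) by (simp add: q_def del: of_nat_Suc)
      have "norm (q n) \<le> \<rho>"
        unfolding nq using \<rho>(1) by (intro mult_right_le_one_le) (auto simp: inverse_le_1_iff)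
      then show "norm (q n) * norm v \<le> r"
        using \<rho>(2) mult_right_mono[of "norm (q n)" \<rho> "norm v"] by simp
    qed
    define f where "f n t = (H (\<gamma> t + q n *s v) $ i - H (\<gamma> t) $ i) / q n" for n t
    have in_S: "\<gamma> t + s *s v \<in> cball (\<gamma> t0) (2 * r)" "\<gamma> t \<in> cball (\<gamma> t0) (2 * r)"
      if "t \<in> ball t0 e" "norm s * norm v \<le> r" for t s
    proof -
      have "\<gamma> t \<in> ball (\<gamma> t0) r"
        using e(3) that(1) by blast
      then have "dist (\<gamma> t0) (\<gamma> t) < r"
        by simp
      moreover have "dist (\<gamma> t) (\<gamma> t + s *s v) \<le> r"
        using that(2) by (simp add: dist_norm norm_smult_C2)
      ultimately show "\<gamma> t + s *s v \<in> cball (\<gamma> t0) (2 * r)" "\<gamma> t \<in> cball (\<gamma> t0) (2 * r)"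
        using dist_triangle[of "\<gamma> t0" "\<gamma> t + s *s v" "\<gamma> t"] r(1) by auto
    qed
    have hol_f: "f n holomorphic_on ball t0 e" for n
      unfolding f_def using q[of n] in_S[of _ "q n"] in_S[of _ 0] r e holH[of "ball t0 e" "q n *s v"]
        holH[of "ball t0 e" 0]
      by (intro holomorphic_intros) (auto simp: subset_iff)
    have unif: "uniform_limit (ball t0 e) f (\<lambda>t. D H (\<gamma> t) v $ i) sequentially"
    proof (rule uniform_limitI)
      fix \<epsilon> :: real assume \<epsilon>: "\<epsilon> > 0"
      have "uniformly_continuous_on (cball (\<gamma> t0) (2 * r)) (\<lambda>z. D H z v)"
        using continuous_on_D[OF H S] r(2)
        by (intro compact_uniformly_continuous) (auto intro: continuous_on_subset)
      then obtain d where d: "d > 0" "\<And>x y. x \<in> cball (\<gamma> t0) (2 * r) \<Longrightarrow> y \<in> cball (\<gamma> t0) (2 * r) \<Longrightarrow>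
          dist y x < d \<Longrightarrow> dist (D H y v) (D H x v) < \<epsilon> / 2"
        unfolding uniformly_continuous_on_def using \<epsilon> by (metis half_gt_zero)
      have "(\<lambda>n. norm (q n) * norm v) \<longlonglongrightarrow> \<rho> * 0 * norm v"
        unfolding nq by (intro tendsto_intros LIMSEQ_inverse_real_of_nat)
      then have "\<forall>\<^sub>F n in sequentially. norm (q n) * norm v < d"
        using order_tendstoD(2)[of _ _ _ d] d(1) by simp
      then show "\<forall>\<^sub>F n in sequentially. \<forall>t\<in>ball t0 e. dist (f n t) (D H (\<gamma> t) v $ i) < \<epsilon>"
      proof (rule eventually_mono, intro ballI)
        fix n t assume n: "norm (q n) * norm v < d" and t: "t \<in> ball t0 e"
        define z where "z = \<gamma> t"
        \<comment> \<open>The increment of \<open>h\<close> is \<open>q n\<close> times the error of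
          the difference quotient. Its derivative is a difference of values of \<open>D H\<close> at
          nearby points, hence small uniformly in \<open>t\<close>.\<close>
        define h where "h s = H (z + s *s v) $ i - s * D H z v $ i" for s
        have le: "norm s * norm v \<le> norm (q n) * norm v" if "norm s \<le> norm (q n)" for s :: complex
          using that by (rule mult_right_mono) simp
        have "norm (h (q n) - h 0) \<le> \<epsilon> / 2 * norm (q n - 0)"
        proof (rule field_differentiable_bound[of "cball 0 (norm (q n))" h
              "\<lambda>s. D H (z + s *s v) v $ i - D H z v $ i"])
          fix s :: complex assume "s \<in> cball 0 (norm (q n))"
          then have s: "norm s * norm v \<le> norm (q n) * norm v"
            using le by simp
          then have sr: "norm s * norm v \<le> r"
            using q(2)[of n] by simp
          have zs: "z + s *s v \<in> cball (\<gamma> t0) (2 * r)" "z \<in> cball (\<gamma> t0) (2 * r)"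
            unfolding z_def by (rule in_S[OF t sr])+
          then have "z + s *s v \<in> S" using r(2) by blast
          have "(h has_field_derivative D H (z + s *s v) v $ i - D H z v $ i) (at s)"
            unfolding h_def
            by (rule derivative_eq_intros has_field_derivative_slice[OF H \<open>z + s *s v \<in> S\<close>] refl)+ simp
          then show "(h has_field_derivative D H (z + s *s v) v $ i - D H z v $ i)
              (at s within cball 0 (norm (q n)))"
            using has_field_derivative_at_within by blast
          have "dist (z + s *s v) z < d"
            using s n by (simp add: dist_norm norm_smult_C2)
          then have "dist (D H (z + s *s v) v) (D H z v) < \<epsilon> / 2"
            using d(2) zs by blast
          then show "norm (D H (z + s *s v) v $ i - D H z v $ i) \<le> \<epsilon> / 2"
            using Finite_Cartesian_Product.norm_nth_le[of "D H (z + s *s v) v - D H z v" i]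
            by (simp add: dist_norm)
        qed auto
        moreover have "h (q n) - h 0 = q n * (f n t - D H (\<gamma> t) v $ i)"
          using q(1)[of n] by (simp add: h_def f_def z_def field_simps)
        ultimately have "norm (q n) * norm (f n t - D H (\<gamma> t) v $ i) \<le> norm (q n) * (\<epsilon> / 2)"
          by (simp add: norm_mult mult.commute)
        then have "norm (f n t - D H (\<gamma> t) v $ i) \<le> \<epsilon> / 2"
          using q(1)[of n] by simp
        then show "dist (f n t) (D H (\<gamma> t) v $ i) < \<epsilon>"
          using \<epsilon> by (simp add: dist_norm)
      qed
    qed
    have "(\<lambda>t. D H (\<gamma> t) v $ i) holomorphic_on ball t0 e"
    proof (rule holomorphic_uniform_sequence[OF open_ball hol_f])
      fix x assume "x \<in> ball t0 e"
      then obtain d where "0 < d" "cball x d \<subseteq> ball t0 e"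
        by (meson open_ball open_contains_cball)
      then show "\<exists>d. 0 < d \<and> cball x d \<subseteq> ball t0 e \<and>
          uniform_limit (cball x d) f (\<lambda>t. D H (\<gamma> t) v $ i) sequentially"
        using uniform_limit_on_subset[OF unif] by blast
    qed
    then show ?thesis using e(1) by blast
  qed
  have "(\<lambda>t. D H (\<gamma> t) v $ i) field_differentiable at t0" if t0: "t0 \<in> T" for t0
  proof -
    obtain e where "e > 0" "(\<lambda>t. D H (\<gamma> t) v $ i) holomorphic_on ball t0 e"
      using local[OF t0] by blast
    then show ?thesis
      using holomorphic_on_imp_differentiable_at[OF _ open_ball] by simp
  qed
  then show ?thesis
    by (metis field_differentiable_at_within holomorphic_onI)
qed

section \<open>Backward orbits in an expanding cone\<close>

lemma eigenvalue_cong: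
  assumes "clin L" "clin L'" "tr2 L = tr2 L'" "det2 L = det2 L'"
  shows "eigenvalue L c \<longleftrightarrow> eigenvalue L' c"
proof -
  have "eigenvalue M' c" if M: "eigenvalue M c" "clin M" "clin M'" "tr2 M = tr2 M'" "det2 M = det2 M'" for M M'
  proof -
    obtain b where "eigenpair M c b"
      using eigenvalue_eigenpair[OF M(2,1)] by blast
    then have "eigenpair M' c b"
      using M by (simp add: eigenpair_def)
    then show ?thesis by (rule eigenpair_eigenvalue)
  qed
  then show ?thesis using assms by metis
qed

lemma stable_cong:
  assumes "clin L" "clin L'" "tr2 L = tr2 L'" "det2 L = det2 L'"
  shows "stable L \<longleftrightarrow> stable L'"
  unfolding stable_def eigenvalue_cong[OF assms] ..

text \<open>If \<open>v\<close> were not a multiple of \<open>e\<close>, the two would span the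
  plane and \<open>L\<close> would vanish, also at \<open>u\<close>.\<close>

lemma kernel_dim1:
  assumes L: "clin L" and "L e = 0" "e \<noteq> 0" "L u \<noteq> 0" "L v = 0"
  shows "\<exists>c. v = c *s e"
proof -
  obtain i where i: "e $ i \<noteq> 0"
    using assms(3) by (auto simp: vec_eq_iff)
  define j :: 2 where "j = (if i = 1 then 2 else 1)"
  have ij: "x = y \<longleftrightarrow> x $ i = y $ i \<and> x $ j = y $ j" for x y :: C2
    using exhaust_2[of i] by (auto simp: vec_eq_iff forall_2 j_def)
  define v' where "v' = v - (v $ i / e $ i) *s e"
  have v': "v' $ i = 0" "L v' = 0"
    using i assms(2,5) by (simp_all add: v'_def clinD[OF L])
  have "v' = 0"
  proof (rule ccontr)
    assume "v' \<noteq> 0"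
    then have j: "v' $ j \<noteq> 0"
      using v'(1) by (simp add: ij)
    define a where "a = u $ i / e $ i"
    define b where "b = (u $ j - a * e $ j) / v' $ j"
    have "u = a *s e + b *s v'"
      using i j v'(1) by (simp add: ij a_def b_def)
    then have "L u = 0"
      using assms(2) v'(2) by (simp add: clinD[OF L])
    with assms(4) show False by simp
  qed
  then show ?thesis
    unfolding v'_def by (intro exI[of _ "v $ i / e $ i"]) simp
qed

text \<open>A cone point near \<open>p\<close> needs many steps of \<open>H\<close> to leave the
  ball, and it does leave because \<open>f\<close> grows geometrically. A limit of the last points
  before the exit has its whole backward orbit in the ball and the cone. There \<open>f\<close>
  shrinks by the factor \<open>s\<close> with each backward step, starting from a positive value, so
  the starting point is never revisited.\<close>

lemma ex_nonperiodic_backward_orbit: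
  fixes H K :: "C2 \<Rightarrow> C2"
  assumes r: "r > 0" and H: "continuous_on (cball p r) H" and K: "continuous_on (cball p r) K"
    and KH: "\<And>z. z \<in> cball p r \<Longrightarrow> K (H z) = z" and Hp: "H p = p"
    and C: "closed C" "v \<noteq> 0" "\<And>t. t *s v \<in> C"
    and f: "continuous_on UNIV f" and s: "s > (1::real)" and c: "c > (0::real)"
    and lower: "\<And>v. v \<in> C \<Longrightarrow> c * norm v \<le> f v"
    and grow: "\<And>z. z \<in> cball p r \<Longrightarrow> z - p \<in> C \<Longrightarrow> H z - p \<in> C \<and> s * f (z - p) \<le> f (H z - p)"
  shows "\<exists>w. (\<forall>j. (K ^^ j) w \<in> cball p r) \<and> (\<forall>j\<ge>1. (K ^^ j) w \<noteq> w)"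
proof -
  have near: "\<exists>d>0. \<forall>z. dist p z < d \<longrightarrow> (\<forall>j\<le>m. (H ^^ j) z \<in> ball p r)" for m
  proof (induction m)
    case 0 show ?case using r by auto
  next
    case (Suc m)
    then obtain d where d: "d > 0" "\<And>z j. dist p z < d \<Longrightarrow> j \<le> m \<Longrightarrow> (H ^^ j) z \<in> ball p r"
      by blast
    obtain d' where d': "d' > 0" "\<And>z. z \<in> cball p r \<Longrightarrow> dist z p < d' \<Longrightarrow> dist (H z) (H p) < d"
      using H d(1) r unfolding continuous_on_iff by (metis centre_in_cball less_imp_le)
    have "(H ^^ j) z \<in> ball p r" if z: "dist p z < min d' r" and j: "j \<le> Suc m" for z j
    proof (cases j)
      case 0 with z show ?thesis by simp
    next
      case (Suc i)
      have "dist p (H z) < d"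
        using d'(2)[of z] z Hp by (simp add: dist_commute)
      then show ?thesis
        using d(2)[of "H z" i] Suc j by (simp add: funpow_swap1)
    qed
    then show ?case
      using d'(1) r by (intro exI[of _ "min d' r"]) auto
  qed
  have "\<exists>z. z \<noteq> p \<and> z - p \<in> C \<and> (\<forall>j\<le>m. (H ^^ j) z \<in> ball p r)" for m
  proof -
    obtain d where d: "d > 0" "\<And>z. dist p z < d \<Longrightarrow> \<forall>j\<le>m. (H ^^ j) z \<in> ball p r"
      using near[of m] by blast
    define t where "t = complex_of_real (d / 2 / norm v)"
    have "norm (t *s v) = d / 2"
      using C(2) d(1) unfolding norm_smult_C2 t_def norm_of_real by simp
    then show ?thesis
      using d C(2,3) by (intro exI[of _ "p + t *s v"]) (auto simp: dist_norm)
  qed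
  then obtain Z where Z: "\<And>m. Z m \<noteq> p" "\<And>m. Z m - p \<in> C" "\<And>m j. j \<le> m \<Longrightarrow> (H ^^ j) (Z m) \<in> ball p r"
    by metis
  have inC: "(H ^^ j) (Z m) - p \<in> C \<and> s ^ j * f (Z m - p) \<le> f ((H ^^ j) (Z m) - p)"
    if "\<And>i. i < j \<Longrightarrow> (H ^^ i) (Z m) \<in> ball p r" for j m
    using that
  proof (induction j)
    case 0 show ?case using Z(2) by simp
  next
    case (Suc j)
    then have IH: "(H ^^ j) (Z m) - p \<in> C" "s ^ j * f (Z m - p) \<le> f ((H ^^ j) (Z m) - p)"
      by auto
    have "(H ^^ j) (Z m) \<in> cball p r"
      using Suc.prems[of j] by auto
    note g = grow[OF this IH(1)]
    have "s * (s ^ j * f (Z m - p)) \<le> s * f ((H ^^ j) (Z m) - p)"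
      using IH(2) s by (intro mult_left_mono) auto
    with g show ?case by (simp add: mult.assoc)
  qed
  have "compact (f ` cball 0 r)"
    using f by (intro compact_continuous_image compact_cball continuous_on_subset[OF f]) auto
  then obtain b where b: "\<And>x. x \<in> cball 0 r \<Longrightarrow> \<bar>f x\<bar> \<le> b"
    using compact_imp_bounded bounded_iff by (metis image_eqI real_norm_def)
  have exit: "\<exists>j. (H ^^ j) (Z m) \<notin> ball p r" for m
  proof (rule ccontr)
    assume "\<not> ?thesis"
    then have all: "(H ^^ j) (Z m) \<in> ball p r" for j by blast
    have "0 < c * norm (Z m - p)"
      using c Z(1) by simp
    then have pos: "0 < f (Z m - p)"
      using lower[OF Z(2), of m] by linarith
    obtain j where "b / f (Z m - p) < s ^ j"
      using real_arch_pow[OF s] by blast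
    then have "b < s ^ j * f (Z m - p)"
      using pos by (simp add: divide_less_eq)
    also have "\<dots> \<le> f ((H ^^ j) (Z m) - p)"
      using inC all by blast
    also have "\<dots> \<le> b"
      using b[of "(H ^^ j) (Z m) - p"] all[of j] by (simp add: dist_norm norm_minus_commute)
    finally show False by simp
  qed
  define J where "J m = (LEAST j. (H ^^ j) (Z m) \<notin> ball p r)" for m
  have J: "(H ^^ J m) (Z m) \<notin> ball p r" for m
    unfolding J_def by (rule LeastI_ex) (rule exit)
  have J': "(H ^^ j) (Z m) \<in> ball p r" if "j < J m" for j m
    using that not_less_Least unfolding J_def by blast
  have mJ: "m < J m" for m
    using J[of m] Z(3)[of "J m" m] by (meson not_less)
  \<comment> \<open>The last point before the exit. Since \<open>m < J m\<close>, at least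
    \<open>m\<close> backward iterates of \<open>w m\<close> stay in the ball and the cone, so a
    limit has all of them there.\<close>
  define w where "w m = (H ^^ (J m - 1)) (Z m)" for m
  have Kw: "(K ^^ j) (w m) = (H ^^ (J m - 1 - j)) (Z m)" if "j \<le> m" for j m
    using that
  proof (induction j)
    case 0 show ?case by (simp add: w_def)
  next
    case (Suc j)
    then have "J m - 1 - j = Suc (J m - 1 - Suc j)"
      using mJ[of m] by simp
    moreover have "(H ^^ (J m - 1 - Suc j)) (Z m) \<in> cball p r"
      using J'[of "J m - 1 - Suc j" m] mJ[of m] by (simp add: less_imp_le)
    ultimately show ?case
      using Suc KH by simp
  qed
  have w_in: "(K ^^ j) (w m) \<in> cball p r" "(K ^^ j) (w m) - p \<in> C" if "j \<le> m" for j m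
  proof -
    have i: "J m - 1 - j < J m" using mJ[of m] by simp
    show "(K ^^ j) (w m) \<in> cball p r"
      using J'[OF i] unfolding Kw[OF that] by auto
    show "(K ^^ j) (w m) - p \<in> C"
      using inC[of "J m - 1 - j" m] J' i unfolding Kw[OF that] by force
  qed
  have HK: "H ((K ^^ Suc j) (w m)) = (K ^^ j) (w m)" if "Suc j \<le> m" for j m
  proof -
    have "J m - 1 - j = Suc (J m - 1 - Suc j)"
      using that mJ[of m] by simp
    then show ?thesis
      using Kw[OF that] Kw[of j m] that by simp
  qed
  have "\<forall>m. w m \<in> cball p r"
    using w_in(1)[of 0] by simp
  moreover have "seq_compact (cball p r)"
    using compact_cball compact_eq_seq_compact_metric by blast
  ultimately obtain l \<sigma> where l: "l \<in> cball p r" "strict_mono \<sigma>" "(w \<circ> \<sigma>) \<longlonglongrightarrow> l"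
    unfolding seq_compact_def by blast
  define x where "x j = (K ^^ j) l" for j
  have ev: "\<forall>\<^sub>F m in sequentially. j \<le> \<sigma> m" for j
    using eventually_subseq[OF l(2) eventually_ge_at_top[of j]] .
  have x: "(\<lambda>m. (K ^^ j) (w (\<sigma> m))) \<longlonglongrightarrow> x j \<and> x j \<in> cball p r" for j
  proof (induction j)
    case 0 show ?case using l by (simp add: x_def o_def)
  next
    case (Suc j)
    have "(\<lambda>m. K ((K ^^ j) (w (\<sigma> m)))) \<longlonglongrightarrow> K (x j)"
      by (rule continuous_on_tendsto_compose[OF K]) (use Suc ev[of j] w_in in \<open>auto elim: eventually_mono\<close>)
    then have lim: "(\<lambda>m. (K ^^ Suc j) (w (\<sigma> m))) \<longlonglongrightarrow> x (Suc j)"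
      by (simp add: x_def)
    have "\<forall>\<^sub>F m in sequentially. (K ^^ Suc j) (w (\<sigma> m)) \<in> cball p r"
      using ev[of "Suc j"] by (rule eventually_mono) (rule w_in)
    with lim show ?case
      using Lim_in_closed_set[OF closed_cball _ _ lim] by simp
  qed
  have xC: "x j - p \<in> C" for j
  proof (rule Lim_in_closed_set[OF C(1)])
    show "(\<lambda>m. (K ^^ j) (w (\<sigma> m)) - p) \<longlonglongrightarrow> x j - p"
      using x by (intro tendsto_diff tendsto_const) blast
    show "\<forall>\<^sub>F m in sequentially. (K ^^ j) (w (\<sigma> m)) - p \<in> C"
      using ev[of j] by (rule eventually_mono) (rule w_in)
  qed simp
  have Hx: "H (x (Suc j)) = x j" for j
  proof (rule LIMSEQ_unique)
    show "(\<lambda>m. H ((K ^^ Suc j) (w (\<sigma> m)))) \<longlonglongrightarrow> H (x (Suc j))"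
    proof (rule continuous_on_tendsto_compose[OF H])
      show "\<forall>\<^sub>F m in sequentially. (K ^^ Suc j) (w (\<sigma> m)) \<in> cball p r"
        using ev[of "Suc j"] by (rule eventually_mono) (rule w_in)
    qed (use x[of "Suc j"] in auto)
    have "\<forall>\<^sub>F m in sequentially. (K ^^ j) (w (\<sigma> m)) = H ((K ^^ Suc j) (w (\<sigma> m)))"
      using ev[of "Suc j"] by (rule eventually_mono) (rule HK[symmetric])
    then show "(\<lambda>m. H ((K ^^ Suc j) (w (\<sigma> m)))) \<longlonglongrightarrow> x j"
      by (rule Lim_transform_eventually[OF conjunct1[OF x]])
  qed
  \<comment> \<open>The images \<open>H (w m)\<close> lie outside the open ball, so
    \<open>H l\<close> does too, whereas \<open>H p = p\<close>.\<close>
  have "l \<noteq> p"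
  proof
    assume "l = p"
    have "(\<lambda>m. H (w (\<sigma> m))) \<longlonglongrightarrow> H l"
      by (rule continuous_on_tendsto_compose[OF H]) (use l w_in(1)[of 0] in \<open>auto simp: o_def\<close>)
    moreover have "H (w m) \<in> - ball p r" for m
    proof -
      obtain i where "J m = Suc i" using mJ[of m] by (cases "J m") auto
      then show ?thesis using J[of m] by (simp add: w_def)
    qed
    ultimately have "H l \<in> - ball p r"
      by (intro Lim_in_closed_set[of "- ball p r" "\<lambda>m. H (w (\<sigma> m))" sequentially]) auto
    then show False using Hp r \<open>l = p\<close> by simp
  qed
  then have "0 < c * norm (l - p)"
    using c by simp
  then have pos: "0 < f (l - p)"
    using lower[OF xC[of 0]] by (simp add: x_def)
  have decay: "s ^ j * f (x j - p) \<le> f (l - p)" for j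
  proof (induction j)
    case 0 show ?case by (simp add: x_def)
  next
    case (Suc j)
    have "s * f (x (Suc j) - p) \<le> f (x j - p)"
      using grow[OF _ xC[of "Suc j"]] x[of "Suc j"] by (simp add: Hx)
    then have "s ^ j * (s * f (x (Suc j) - p)) \<le> s ^ j * f (x j - p)"
      using s by (intro mult_left_mono) auto
    with Suc show ?case by (simp add: algebra_simps)
  qed
  have "x j \<noteq> l" if "j \<ge> 1" for j
  proof
    assume "x j = l"
    have "1 < s ^ j" using s that by (intro one_less_power) auto
    then have "f (l - p) < s ^ j * f (l - p)" using pos by simp
    with decay[of j] \<open>x j = l\<close> show False by simp
  qed
  then show ?thesis
    using x unfolding x_def by blast
qed

section \<open>Periodic points of a map with finite orbits\<close>

locale finite_orbit_map = pointwise_periodic F G A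
  for F G :: "C2 \<Rightarrow> C2" and A :: "C2 set" +
  assumes hol_F: "holomorphic_C2 F A" and hol_G: "holomorphic_C2 G A"
begin

lemma swap_finite_orbit_map: "finite_orbit_map G F A"
  by (intro finite_orbit_map.intro swap finite_orbit_map_axioms.intro hol_F hol_G)

lemma holomorphic_funpow: "holomorphic_C2 (F ^^ k) (reach k)"
proof (induction k)
  case 0
  have "F ^^ 0 = (\<lambda>z. z)" by auto
  then show ?case using holomorphic_C2_id by metis
next
  case (Suc k)
  have "F ^^ Suc k = (\<lambda>z. F ((F ^^ k) z))" by auto
  moreover have "holomorphic_C2 (F ^^ k) (reach (Suc k))"
    using Suc holomorphic_C2_subset reach_mono[of k "Suc k"] by auto
  ultimately show ?case
    using holomorphic_C2_comp[OF _ hol_F, of "F ^^ k" "reach (Suc k)"] by (auto simp: reach_Suc)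
qed

text \<open>\<open>n\<close> is any period, not the least one, so these sets increase along
  divisibility.\<close>

definition per :: "nat \<Rightarrow> C2 set" where
  "per n = {p \<in> invariant_part A. (F ^^ n) p = p}"

abbreviation DF :: "nat \<Rightarrow> C2 \<Rightarrow> C2 \<Rightarrow> C2" where
  "DF n \<equiv> D (F ^^ n)"

lemma per_reach: "p \<in> per n \<Longrightarrow> p \<in> reach k"
  using invariant_part_reach[of A] by (auto simp: per_def)

lemma funpow_mult_fixed: "(F ^^ n) p = p \<Longrightarrow> (F ^^ (n * k)) p = p"
  by (induction k) (simp_all add: funpow_add)

lemma per_mult: "per n \<subseteq> per (n * k)"
  by (auto simp: per_def funpow_mult_fixed)

lemma per_I:
  assumes "z \<in> reach n" "n \<ge> 1" "(F ^^ n) z = z"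
  shows "z \<in> per n"
proof -
  have "(F ^^ k) z \<in> A" for k
  proof -
    have "(F ^^ k) z = (F ^^ (k mod n)) ((F ^^ (n * (k div n))) z)"
      by (metis funpow_add mod_mult_div_eq add.commute comp_apply)
    also have "\<dots> = (F ^^ (k mod n)) z"
      by (simp add: funpow_mult_fixed[OF assms(3)])
    also have "\<dots> \<in> A"
      using assms(1,2) by (simp add: reach_def)
    finally show ?thesis .
  qed
  then show ?thesis
    using assms(3) by (simp add: per_def invariant_part_def)
qed

lemma has_derivative_DF:
  assumes "p \<in> reach n"
  shows "((F ^^ n) has_derivative DF n p) (at p)" "clin (DF n p)"
  using holomorphic_C2D[OF holomorphic_funpow assms] .

lemma DF_mult:
  assumes "p \<in> per n"
  shows "DF (n * k) p = DF n p ^^ k"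
proof (induction k)
  case 0
  have "((F ^^ 0) has_derivative id) (at p)"
    by (simp add: id_def)
  then show ?case
    using D_unique by (metis funpow_0 eq_id_iff mult_0_right)
next
  case (Suc k)
  have "(F ^^ (n * k)) p = p"
    using assms funpow_mult_fixed by (auto simp: per_def)
  then have "((\<lambda>z. (F ^^ n) ((F ^^ (n * k)) z)) has_derivative (\<lambda>v. DF n p (DF (n * k) p v))) (at p)"
    using D_comp[OF holomorphic_funpow holomorphic_funpow, of p "n * k" n] per_reach[OF assms] by simp
  moreover have "(\<lambda>z. (F ^^ n) ((F ^^ (n * k)) z)) = F ^^ (n * Suc k)"
    by (auto simp: funpow_add)
  ultimately have "DF (n * Suc k) p = (\<lambda>v. DF n p (DF (n * k) p v))"
    using D_unique by metis
  then show ?case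
    by (auto simp: Suc)
qed

lemma per_swap:
  assumes p: "p \<in> per n" and n: "n \<ge> 1"
  shows "p \<in> finite_orbit_map.per G A n"
proof -
  interpret bw: finite_orbit_map G F A by (rule swap_finite_orbit_map)
  have Gp: "(G ^^ j) p = (F ^^ (n * j - j)) p" for j
  proof -
    have "(G ^^ j) ((F ^^ (n * j)) p) = (F ^^ (n * j - j)) p"
      using n by (intro G_funpow_F per_reach[OF p]) simp
    then show ?thesis
      using p funpow_mult_fixed by (simp add: per_def)
  qed
  then have "(G ^^ j) p \<in> A" for j
    using p by (simp add: per_def invariant_part_def)
  moreover have "n * n - n = n * (n - 1)"
    by (simp add: algebra_simps)
  then have "(G ^^ n) p = p"
    using Gp[of n] p funpow_mult_fixed by (simp add: per_def)
  ultimately show ?thesis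
    by (simp add: bw.per_def bw.invariant_part_def)
qed

lemma DF_inverse:
  assumes p: "p \<in> per n" and n: "n \<ge> 1"
  shows "D (G ^^ n) p (DF n p v) = v"
proof -
  interpret bw: finite_orbit_map G F A by (rule swap_finite_orbit_map)
  have pn: "(F ^^ n) p = p" using p by (simp add: per_def)
  have "((\<lambda>z. (G ^^ n) ((F ^^ n) z)) has_derivative (\<lambda>v. D (G ^^ n) p (DF n p v))) (at p)"
    using D_comp[OF holomorphic_funpow bw.holomorphic_funpow, of p n n] per_reach[OF p]
      bw.per_reach[OF per_swap[OF p n]] by (simp add: pn)
  then have "((\<lambda>z. z) has_derivative (\<lambda>v. D (G ^^ n) p (DF n p v))) (at p)"
    by (rule has_derivative_transform_within_open[OF _ open_reach[of n] per_reach[OF p]])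
       (simp add: G_funpow_F[OF _ order_refl])
  moreover have "((\<lambda>z. z) has_derivative (\<lambda>v. v)) (at p)" by simp
  ultimately have "(\<lambda>v. D (G ^^ n) p (DF n p v)) = (\<lambda>v. v)"
    by (rule has_derivative_unique)
  then show ?thesis by metis
qed

text \<open>If \<open>norm a > 1\<close>, the remainder of \<open>F ^^ n\<close> at \<open>p\<close>
  is at most \<open>e * norm (z - p)\<close> near \<open>p\<close>, so the expanding cone of the
  derivative is one for \<open>F ^^ n\<close> itself. The resulting orbit of \<open>G ^^ n\<close>
  is not periodic, although a \<open>G\<close>-orbit that stays in \<open>A\<close> has to
  be.\<close>

lemma eigenvalue_le_1:
  assumes p: "p \<in> per n" and n: "n \<ge> 1" and a: "eigenvalue (DF n p) a"
  shows "norm a \<le> 1"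
proof (rule ccontr)
  assume "\<not> norm a \<le> 1"
  then have "norm a > 1" by simp
  interpret bw: finite_orbit_map G F A by (rule swap_finite_orbit_map)
  have pr: "p \<in> reach n" "p \<in> bw.reach n"
    using per_reach[OF p] bw.per_reach[OF per_swap[OF p n]] by auto
  have Hp: "(F ^^ n) p = p" using p by (simp add: per_def)
  note DF = has_derivative_DF[OF pr(1)]
  obtain C f s e c where E: "expanding_cone (DF n p) C f s e c"
    using ex_expanding_cone[OF DF(2) a \<open>norm a > 1\<close>] by blast
  then obtain v where C: "closed C" "v \<noteq> 0" "\<And>t. t *s v \<in> C"
    and f: "continuous_on UNIV f" and s: "s > 1" and e: "e > 0" and c: "c > 0"
    and lower: "\<And>v. v \<in> C \<Longrightarrow> c * norm v \<le> f v"
    and step: "\<And>v h. v \<in> C \<Longrightarrow> norm h \<le> e * norm v \<Longrightarrow>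
      DF n p v + h \<in> C \<and> s * f v \<le> f (DF n p v + h)"
    unfolding expanding_cone_def by blast
  obtain d where d: "d > 0" "\<And>z. norm (z - p) < d \<Longrightarrow>
      norm ((F ^^ n) z - (F ^^ n) p - DF n p (z - p)) \<le> e * norm (z - p)"
    using DF(1) e unfolding has_derivative_at_alt by blast
  \<comment> \<open>On this set the intermediate iterates of \<open>G\<close> also stay in
    \<open>A\<close>, so that an orbit of \<open>G ^^ n\<close> in the ball comes from a
    \<open>G\<close>-orbit in \<open>A\<close>.\<close>
  have "open (reach n \<inter> bw.reach n)"
    using open_reach bw.open_reach by blast
  then obtain r0 where r0: "r0 > 0" "cball p r0 \<subseteq> reach n \<inter> bw.reach n"
    using pr open_contains_cball by blast
  define r where "r = min r0 (d / 2)"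
  have r: "r > 0" "r < d" "cball p r \<subseteq> reach n" "cball p r \<subseteq> bw.reach n"
  proof -
    show "r > 0" "r < d" using r0 d(1) by (auto simp: r_def)
    have "cball p r \<subseteq> cball p r0" by (auto simp: r_def)
    then show "cball p r \<subseteq> reach n" "cball p r \<subseteq> bw.reach n" using r0(2) by blast+
  qed
  have "\<exists>w. (\<forall>j. ((G ^^ n) ^^ j) w \<in> cball p r) \<and> (\<forall>j\<ge>1. ((G ^^ n) ^^ j) w \<noteq> w)"
  proof (rule ex_nonperiodic_backward_orbit[where H = "F ^^ n" and C = C and f = f and s = s and c = c and v = v])
    show "continuous_on (cball p r) (F ^^ n)" "continuous_on (cball p r) (G ^^ n)"
      using continuous_on_reach bw.continuous_on_reach r(3,4) continuous_on_subset by blast+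
    show "(G ^^ n) ((F ^^ n) z) = z" if "z \<in> cball p r" for z
      using G_funpow_F[of z n n] that r(3) by auto
    fix z assume z: "z \<in> cball p r" "z - p \<in> C"
    define h where "h = (F ^^ n) z - p - DF n p (z - p)"
    have "norm (z - p) < d"
      using z(1) r(2) by (simp add: dist_norm norm_minus_commute)
    then have "norm h \<le> e * norm (z - p)"
      using d(2)[of z] by (simp add: h_def Hp)
    moreover have "(F ^^ n) z - p = DF n p (z - p) + h"
      by (simp add: h_def)
    ultimately show "(F ^^ n) z - p \<in> C \<and> s * f (z - p) \<le> f ((F ^^ n) z - p)"
      using step[OF z(2)] by simp
  qed (use r(1) Hp C f s c lower in auto)
  then obtain w where w: "\<And>j. ((G ^^ n) ^^ j) w \<in> cball p r" "\<And>j. j \<ge> 1 \<Longrightarrow> ((G ^^ n) ^^ j) w \<noteq> w"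
    by blast
  have "(G ^^ k) w \<in> A" for k
  proof -
    have "(G ^^ k) w = (G ^^ (k mod n)) (((G ^^ n) ^^ (k div n)) w)"
      by (metis funpow_add mod_mult_div_eq add.commute comp_apply funpow_mult)
    moreover have "((G ^^ n) ^^ (k div n)) w \<in> bw.reach n"
      using w(1) r(4) by blast
    ultimately show ?thesis
      using n by (simp add: bw.reach_def)
  qed
  then obtain m where m: "m \<ge> 1" "(G ^^ m) w = w"
    using periodic_G by blast
  then have "((G ^^ n) ^^ m) w = w"
    using bw.funpow_mult_fixed[OF m(2), of n] by (simp add: funpow_mult mult.commute)
  with w(2) m(1) show False by blast
qed

text \<open>The inverse of \<open>a\<close> is a multiplier of \<open>G\<close> at the same point,
  and the upper bound applies to both.\<close>

lemma eigenvalue_norm_1: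
  assumes p: "p \<in> per n" and n: "n \<ge> 1" and a: "eigenvalue (DF n p) a"
  shows "norm a = 1"
proof -
  interpret bw: finite_orbit_map G F A by (rule swap_finite_orbit_map)
  note q = per_swap[OF p n]
  obtain v where v: "v \<noteq> 0" "DF n p v = a *s v"
    using a by (auto simp: eigenvalue_def)
  have "v = D (G ^^ n) p (a *s v)"
    using DF_inverse[OF p n, of v] v(2) by simp
  also have "\<dots> = a *s D (G ^^ n) p v"
    using bw.has_derivative_DF(2)[OF bw.per_reach[OF q]] by (simp add: clinD)
  finally have *: "v = a *s D (G ^^ n) p v" .
  then have "a \<noteq> 0" using v(1) by auto
  then have "D (G ^^ n) p v = inverse a *s v"
    by (subst (2) *) (simp add: vector_smult_assoc)
  then have "eigenvalue (D (G ^^ n) p) (inverse a)"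
    using v(1) by (auto simp: eigenvalue_def)
  from bw.eigenvalue_le_1[OF q n this] have "1 \<le> norm a"
    using \<open>a \<noteq> 0\<close> by (simp add: norm_inverse inverse_le_1_iff)
  with eigenvalue_le_1[OF assms] show ?thesis by simp
qed

lemma norm_det2_1:
  assumes p: "p \<in> per n" and n: "n \<ge> 1"
  shows "norm (det2 (DF n p)) = 1"
proof -
  obtain a b where ab: "eigenpair (DF n p) a b"
    using ex_eigenpair has_derivative_DF(2)[OF per_reach[OF p]] by blast
  then show ?thesis
    using eigenvalue_norm_1[OF p n] eigenpair_eigenvalue[OF ab]
      eigenpair_eigenvalue[OF eigenpair_sym[OF ab]]
    by (simp add: eigenpair_def norm_mult)
qed

text \<open>The derivative of \<open>F ^^ n\<close> minus the identity is injective at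
  \<open>p\<close>, so this difference is locally injective and has no other zero nearby.\<close>

lemma isolated_per:
  assumes p: "p \<in> per n" and one: "\<not> eigenvalue (DF n p) 1"
  shows "\<exists>r>0. per n \<inter> ball p r = {p}"
proof -
  let ?H = "\<lambda>z. (F ^^ n) z - z"
  note pr = per_reach[OF p, of n]
  have H: "holomorphic_C2 ?H (reach n)"
    using holomorphic_C2_diff[OF holomorphic_funpow holomorphic_C2_id] .
  have "(?H has_derivative (\<lambda>v. DF n p v - v)) (at p)"
    by (intro has_derivative_diff has_derivative_DF(1)[OF pr] has_derivative_ident)
  from D_unique[OF this] have "v = 0" if "D ?H p v = 0" for v
    using that one unfolding eigenvalue_def by force
  from holomorphic_C2_locally_inj[OF H open_reach pr this]
  obtain r where r: "r > 0" "inj_on ?H (ball p r)" by blast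
  have "per n \<inter> ball p r = {p}"
    using r p inj_onD[OF r(2), of _ p] by (auto simp: per_def)
  then show ?thesis using r(1) by blast
qed

text \<open>The sum of the iterates \<open>F ^^ (n * j)\<close> over \<open>j < k\<close> takes the
  same value at \<open>q\<close> and at \<open>(F ^^ n) q\<close> if \<open>q\<close> has period
  \<open>n * k\<close>, by a cyclic shift of its terms. Stability makes its derivative at
  \<open>p\<close> injective, so it separates points near \<open>p\<close> and
  \<open>(F ^^ n) q = q\<close>.\<close>

lemma stable_per:
  assumes p: "p \<in> per n" and st: "stable (DF n p)" and k: "k \<ge> 1"
  shows "\<exists>r>0. per (n * k) \<inter> ball p r \<subseteq> per n"
proof -
  let ?H = "\<lambda>z. \<Sum>j<k. (F ^^ (n * j)) z"
  let ?S = "reach (n * k)"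
  note pr = per_reach[OF p]
  have le: "n * j \<le> n * k" if "j < k" for j
    using that by simp
  have H: "holomorphic_C2 ?H ?S"
    by (intro holomorphic_C2_sum holomorphic_C2_subset[OF holomorphic_funpow] reach_mono) (auto simp: le)
  have "(?H has_derivative (\<lambda>v. \<Sum>j<k. DF (n * j) p v)) (at p)"
    by (intro has_derivative_sum has_derivative_DF(1)[OF pr])
  then have "D ?H p = (\<lambda>v. \<Sum>j<k. (DF n p ^^ j) v)"
    using D_unique by (simp add: DF_mult[OF p])
  then have "v = 0" if "D ?H p v = 0" for v
    using stable_sum_funpow[OF has_derivative_DF(2)[OF pr] st k] that by simp
  from holomorphic_C2_locally_inj[OF H open_reach pr this]
  obtain r0 where r0: "r0 > 0" "inj_on ?H (ball p r0)" by blast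
  have "isCont (F ^^ n) p"
    using continuous_on_reach open_reach pr continuous_on_eq_continuous_at by blast
  then obtain d where d: "d > 0" "\<And>z. dist z p < d \<Longrightarrow> dist ((F ^^ n) z) p < r0"
    using r0(1) p unfolding continuous_at_eps_delta by (auto simp: per_def)
  have "q \<in> per n" if q: "q \<in> per (n * k)" "dist p q < min d r0" for q
  proof -
    have fix_q: "(F ^^ (n * k)) q = q" using q(1) by (simp add: per_def)
    have "?H ((F ^^ n) q) = (\<Sum>j<k. (F ^^ (n * Suc j)) q)"
      by (intro sum.cong refl) (metis add.commute comp_apply funpow_add mult_Suc_right)
    also have "\<dots> = (\<Sum>j\<in>{1..<Suc k}. (F ^^ (n * j)) q)"
      by (simp add: sum.atLeast_Suc_lessThan_Suc_shift lessThan_atLeast0 del: sum.op_ivl_Suc)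
    also have "\<dots> = (\<Sum>j\<in>{0..<k}. (F ^^ (n * j)) q)"
      using k fix_q by (simp add: sum.atLeast_Suc_lessThan[of 0 k])
    finally have "?H ((F ^^ n) q) = ?H q"
      by (simp add: lessThan_atLeast0)
    moreover have "(F ^^ n) q \<in> ball p r0" "q \<in> ball p r0"
      using q(2) d(2)[of q] by (auto simp: dist_commute)
    ultimately have "(F ^^ n) q = q"
      using inj_onD[OF r0(2)] by blast
    then show ?thesis using q(1) by (simp add: per_def)
  qed
  then show ?thesis
    using d(1) r0(1) by (intro exI[of _ "min d r0"]) auto
qed

text \<open>At a fixed point of \<open>F ^^ n\<close> with eigenvalues \<open>1\<close> and \<open>d \<noteq> 1\<close> the fixed points lie on a
  holomorphic curve, obtained from the projections onto the two eigenlines. Either they are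
  isolated on it, or the whole curve is fixed; then the determinant is a holomorphic function of
  modulus 1 on the curve, hence constant.\<close>

lemma locally_constant_multipliers:
  assumes p: "p \<in> per n" and n: "n \<ge> 1" and nu: "\<not> (tr2 (DF n p) = 2 \<and> det2 (DF n p) = 1)"
  shows "\<exists>r>0. \<forall>q \<in> per n \<inter> ball p r. tr2 (DF n q) = tr2 (DF n p) \<and> det2 (DF n q) = det2 (DF n p)"
proof (cases "eigenvalue (DF n p) 1")
  case False
  from isolated_per[OF p this] obtain r where "r > 0" "per n \<inter> ball p r = {p}" by blast
  then show ?thesis by (intro exI[of _ r]) auto
next
  case True
  note pr = per_reach[OF p, of n]
  note M = has_derivative_DF(2)[OF pr]
  obtain d where d: "eigenpair (DF n p) 1 d"
    using eigenvalue_eigenpair[OF M True] by blast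
  then have "d \<noteq> 1" using nu by (auto simp: eigenpair_def)
  define L where "L v = DF n p v - v" for v
  have L: "clin L"
    unfolding L_def by (intro clinI) (simp_all add: clinD[OF M] vector_ssub_ldistrib)
  have LL: "L (L v) = (d - 1) *s L v" for v
    using eigenpair_image[OF eigenpair_sym[OF d], of v]
    by (simp add: L_def vector_sub_rdistrib)
  have kLL: "(1 / (d - 1)) *s L (L v) = L v" for v
  proof -
    have "1 / (d - 1) * (d - 1) = 1" using \<open>d \<noteq> 1\<close> by simp
    then show ?thesis by (simp only: LL vector_smult_assoc vector_smult_lid)
  qed
  \<comment> \<open>Since L^2 = (d - 1) L, the map L / (d - 1) projects onto the eigenline of
    \<open>d\<close>, and \<open>P\<close> is the complementary projection onto the kernel of
    \<open>L\<close>. In the chart \<Phi> the first component is linear and the second is that of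
    \<open>(F ^^ n) z - z\<close>, so fixed points lie on the line \<Phi> z = t e.\<close>
  define P where "P v = v - (1 / (d - 1)) *s L v" for v
  define \<Phi> where "\<Phi> z = P (z - p) + (1 / (d - 1)) *s L ((F ^^ n) z - z)" for z
  have LP: "L (P v) = 0" for v
    by (simp add: P_def clinD[OF L] kLL)
  have L\<Phi>: "L (\<Phi> z) = L ((F ^^ n) z - z)" for z
    unfolding \<Phi>_def clinD(1)[OF L] LP by (simp only: clinD(2)[OF L] kLL add_0)
  have P: "clin P"
    unfolding P_def
    by (intro clinI) (simp_all add: clinD[OF L] vector_add_ldistrib vector_ssub_ldistrib
        vector_smult_assoc mult.commute)
  have kL: "clin (\<lambda>v. (1 / (d - 1)) *s L v)"
    by (intro clinI) (simp_all add: clinD[OF L] vector_add_ldistrib vector_smult_assoc mult.commute)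
  have H: "holomorphic_C2 (\<lambda>z. (F ^^ n) z - z) (reach n)"
    using holomorphic_C2_diff[OF holomorphic_funpow holomorphic_C2_id] .
  have \<Phi>: "holomorphic_C2 \<Phi> (reach n)"
    unfolding \<Phi>_def
    by (intro holomorphic_C2_add holomorphic_C2_comp[OF holomorphic_C2_diff[OF holomorphic_C2_id
          holomorphic_C2_const] holomorphic_C2_clin[OF P, of UNIV]]
        holomorphic_C2_comp[OF H holomorphic_C2_clin[OF kL, of UNIV]]) auto
  have "(\<Phi> has_derivative (\<lambda>v. P v + (1 / (d - 1)) *s L (L v))) (at p)"
  proof -
    have "((\<lambda>z. (F ^^ n) z - z) has_derivative L) (at p)"
      unfolding L_def by (intro has_derivative_diff has_derivative_DF(1)[OF pr] has_derivative_ident)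
    from bounded_linear.has_derivative[OF clin_bounded_linear[OF kL] this]
    have 1: "((\<lambda>z. (1 / (d - 1)) *s L ((F ^^ n) z - z)) has_derivative
        (\<lambda>v. (1 / (d - 1)) *s L (L v))) (at p)" .
    have "((\<lambda>z. z - p) has_derivative (\<lambda>v. v)) (at p)"
      by (auto intro!: derivative_eq_intros)
    from bounded_linear.has_derivative[OF clin_bounded_linear[OF P] this]
    have 2: "((\<lambda>z. P (z - p)) has_derivative P) (at p)" .
    show ?thesis
      unfolding \<Phi>_def by (rule has_derivative_add[OF 2 1])
  qed
  then have D\<Phi>: "D \<Phi> p = (\<lambda>v. P v + (1 / (d - 1)) *s L (L v))"
    by (rule D_unique)
  have inj: "v = 0" if "D \<Phi> p v = 0" for v
  proof -
    have *: "P v + L v = 0"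
      using that by (simp only: D\<Phi> kLL)
    then have "L (P v) + L (L v) = 0"
      by (simp add: clinD(1)[OF L, symmetric] clinD(3)[OF L])
    then have "(d - 1) *s L v = 0"
      by (simp only: LP LL add_0)
    then have "L v = 0"
      using \<open>d \<noteq> 1\<close> unfolding vector_mul_eq_0 by simp
    with * show "v = 0" by (simp add: P_def)
  qed
  obtain r K where r: "r > 0" "ball p r \<subseteq> reach n" and V: "open (\<Phi> ` ball p r)"
    and K: "holomorphic_C2 K (\<Phi> ` ball p r)" and K\<Phi>: "\<And>z. z \<in> ball p r \<Longrightarrow> K (\<Phi> z) = z"
    using holomorphic_C2_local_inverse[OF \<Phi> open_reach pr inj] by metis
  have fix_p: "(F ^^ n) p = p" using p by (simp add: per_def)
  have \<Phi>p: "\<Phi> p = 0"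
    by (simp add: \<Phi>_def fix_p clinD[OF P] clinD[OF L])
  obtain e where e: "e \<noteq> 0" "L e = 0"
    using True by (auto simp: eigenvalue_def L_def)
  obtain u where u: "u \<noteq> 0" "DF n p u = d *s u"
    using eigenpair_eigenvalue[OF eigenpair_sym[OF d]] by (auto simp: eigenvalue_def)
  have Lu: "L u = (d - 1) *s u"
    by (simp add: L_def u(2) vector_sub_rdistrib)
  have "L u \<noteq> 0"
    unfolding Lu vector_mul_eq_0 using u(1) \<open>d \<noteq> 1\<close> by simp
  note ker = kernel_dim1[OF L e(2,1) this]
  have line: "((\<lambda>t. t *s e) has_derivative (\<lambda>h. h *s e)) (at t)" for t
    using has_derivative_line[of 0 e t] by simp
  have "0 \<in> (\<lambda>t. t *s e) -` (\<Phi> ` ball p r)"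
    using \<Phi>p r(1) by (auto intro!: image_eqI[of _ _ p])
  moreover have "open ((\<lambda>t. t *s e) -` (\<Phi> ` ball p r))"
    using line V by (intro open_vimage continuous_at_imp_continuous_on ballI) (auto intro: has_derivative_continuous)
  ultimately obtain \<epsilon> where \<epsilon>0: "\<epsilon> > 0" "ball 0 \<epsilon> \<subseteq> (\<lambda>t. t *s e) -` (\<Phi> ` ball p r)"
    by (meson openE)
  then have \<epsilon>: "\<epsilon> > 0" "\<And>t. t \<in> ball 0 \<epsilon> \<Longrightarrow> t *s e \<in> \<Phi> ` ball p r"
    by blast+
  define \<gamma> where "\<gamma> t = K (t *s e)" for t
  have \<gamma>: "\<gamma> t \<in> ball p r" "\<Phi> (\<gamma> t) = t *s e" if t: "t \<in> ball 0 \<epsilon>" for t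
  proof -
    obtain z where "z \<in> ball p r" "t *s e = \<Phi> z"
      using \<epsilon>(2)[OF t] by blast
    then show "\<gamma> t \<in> ball p r" "\<Phi> (\<gamma> t) = t *s e"
      by (simp_all add: \<gamma>_def K\<Phi>)
  qed
  have "(\<gamma> has_derivative (\<lambda>h. h *s D K (t *s e) e)) (at t)" if "t \<in> ball 0 \<epsilon>" for t
    unfolding \<gamma>_def by (rule curve_comp[OF K \<epsilon>(2)[OF that] line])
  then obtain w where w: "\<And>t. t \<in> ball 0 \<epsilon> \<Longrightarrow> (\<gamma> has_derivative (\<lambda>h. h *s w t)) (at t)"
    by (rule that)
  have \<gamma>r: "\<gamma> t \<in> reach n" if "t \<in> ball 0 \<epsilon>" for t
    using \<gamma>(1)[OF that] r(2) by blast
  have on_curve: "\<exists>t. norm t * norm e = norm (\<Phi> q) \<and> q = \<gamma> t" if q: "q \<in> per n" "q \<in> ball p r" for q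
  proof -
    have "(F ^^ n) q - q = 0" using q(1) by (simp add: per_def)
    then have "L (\<Phi> q) = 0" by (simp add: L\<Phi> clinD[OF L])
    then obtain t where "\<Phi> q = t *s e" using ker by blast
    then show ?thesis
      using K\<Phi>[OF q(2)] by (intro exI[of _ t]) (simp add: \<gamma>_def norm_smult_C2)
  qed
  have close: "\<exists>r'>0. \<forall>q \<in> per n \<inter> ball p r'. \<exists>t \<in> ball 0 \<delta>. q = \<gamma> t" if \<delta>: "\<delta> > 0" for \<delta>
  proof -
    have "isCont \<Phi> p"
      using holomorphic_C2D(1)[OF \<Phi> pr] has_derivative_continuous by blast
    then obtain r1 where r1: "r1 > 0" "\<And>q. dist q p < r1 \<Longrightarrow> dist (\<Phi> q) (\<Phi> p) < \<delta> * norm e"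
      using \<delta> e(1) unfolding continuous_at_eps_delta by (metis mult_pos_pos zero_less_norm_iff)
    have "\<exists>t \<in> ball 0 \<delta>. q = \<gamma> t" if q: "q \<in> per n" "q \<in> ball p (min r r1)" for q
    proof -
      obtain t where t: "norm t * norm e = norm (\<Phi> q)" "q = \<gamma> t"
        using on_curve[OF q(1)] q(2) by auto
      have "norm (\<Phi> q) < \<delta> * norm e"
        using r1(2)[of q] q(2) by (simp add: \<Phi>p dist_commute)
      then have "norm t < \<delta>"
        using t(1) e(1) by (metis mult_less_cancel_right_pos zero_less_norm_iff)
      then show ?thesis using t(2) by auto
    qed
    then show ?thesis
      using r(1) r1(1) by (intro exI[of _ "min r r1"]) auto
  qed
  have \<gamma>0: "\<gamma> 0 = p"
    using K\<Phi>[of p] r(1) by (simp add: \<gamma>_def \<Phi>p)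
  obtain i where i: "e $ i \<noteq> 0"
    using e(1) by (auto simp: vec_eq_iff)
  \<comment> \<open>On the curve the displacement of \<open>F ^^ n\<close> is already a multiple of
    \<open>e\<close>, so one coordinate in which \<open>e\<close> does not vanish decides whether
    the point is fixed.\<close>
  define a where "a t = ((F ^^ n) (\<gamma> t) - \<gamma> t) $ i" for t
  have a0: "(F ^^ n) (\<gamma> t) = \<gamma> t" if t: "t \<in> ball 0 \<epsilon>" "a t = 0" for t
  proof -
    have "L ((F ^^ n) (\<gamma> t) - \<gamma> t) = L (t *s e)"
      using L\<Phi>[of "\<gamma> t"] \<gamma>(2)[OF t(1)] by simp
    then have "L ((F ^^ n) (\<gamma> t) - \<gamma> t) = 0"
      by (simp add: clinD[OF L] e(2))
    then obtain c where "(F ^^ n) (\<gamma> t) - \<gamma> t = c *s e"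
      using ker by blast
    with t(2) i show ?thesis by (simp add: a_def)
  qed
  have hol_a: "a holomorphic_on ball 0 \<epsilon>"
  proof (rule holomorphic_onI)
    fix t :: complex assume t: "t \<in> ball 0 \<epsilon>"
    from curve_nth[OF curve_comp[OF H \<gamma>r[OF t] w[OF t]], of i]
    have "a field_differentiable at t"
      unfolding a_def field_differentiable_def by (rule exI)
    then show "a field_differentiable at t within ball 0 \<epsilon>"
      by (rule field_differentiable_at_within)
  qed
  have "a 0 = 0" by (simp add: a_def \<gamma>0 fix_p)
  show ?thesis
  proof (cases "\<exists>b \<in> ball 0 \<epsilon>. a b \<noteq> 0")
    case True
    then obtain b where b: "b \<in> ball 0 \<epsilon>" "a b \<noteq> 0" by blast
    have "0 \<in> ball 0 \<epsilon>" using \<epsilon>(1) by simp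
    show ?thesis
    proof (rule isolated_zeros[OF hol_a open_ball connected_ball \<open>0 \<in> ball 0 \<epsilon>\<close> \<open>a 0 = 0\<close> b])
      fix \<delta> assume \<delta>: "0 < \<delta>" "\<And>t. t \<in> ball 0 \<delta> - {0} \<Longrightarrow> a t \<noteq> 0"
      obtain r' where r': "r' > 0" "\<And>q. q \<in> per n \<inter> ball p r' \<Longrightarrow> \<exists>t \<in> ball 0 \<delta>. q = \<gamma> t"
        using close[OF \<delta>(1)] by blast
      have "q = p" if q: "q \<in> per n \<inter> ball p r'" for q
      proof -
        obtain t where t: "t \<in> ball 0 \<delta>" "q = \<gamma> t" using r'(2)[OF q] by blast
        have "a t = 0" using q by (simp add: a_def per_def flip: t(2))
        then have "t = 0" using \<delta>(2)[of t] t(1) by blast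
        then show ?thesis using t(2) \<gamma>0 by simp
      qed
      then show ?thesis using r'(1) by blast
    qed
  next
    case False
    have fixed: "(F ^^ n) (\<gamma> t) = \<gamma> t" "\<gamma> t \<in> per n" if t: "t \<in> ball 0 \<epsilon>" for t
    proof -
      show "(F ^^ n) (\<gamma> t) = \<gamma> t" using a0[OF t] False t by blast
      then show "\<gamma> t \<in> per n" using per_I[OF \<gamma>r[OF t] n] by blast
    qed
    \<comment> \<open>Differentiating the fixed point equation shows that the tangent
      \<open>w t\<close> is fixed by the derivative. It is nonzero because \<Phi> straightens the
      curve to the line of \<open>e\<close>. So 1 remains a multiplier and the other one is the
      determinant.\<close>
    have tr: "tr2 (DF n (\<gamma> t)) = 1 + det2 (DF n (\<gamma> t))" if t: "t \<in> ball 0 \<epsilon>" for t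
    proof -
      have "((\<lambda>t. (F ^^ n) (\<gamma> t)) has_derivative (\<lambda>h. h *s DF n (\<gamma> t) (w t))) (at t)"
        by (rule curve_comp[OF holomorphic_funpow \<gamma>r[OF t] w[OF t]])
      then have "(\<gamma> has_derivative (\<lambda>h. h *s DF n (\<gamma> t) (w t))) (at t)"
        by (rule has_derivative_transform_within_open[OF _ open_ball t]) (rule fixed)
      from has_derivative_unique[OF this w[OF t]]
      have "1 *s DF n (\<gamma> t) (w t) = 1 *s w t" by meson
      moreover have "w t \<noteq> 0"
      proof
        assume "w t = 0"
        have "((\<lambda>t. \<Phi> (\<gamma> t)) has_derivative (\<lambda>h. h *s D \<Phi> (\<gamma> t) (w t))) (at t)"
          by (rule curve_comp[OF \<Phi> \<gamma>r[OF t] w[OF t]])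
        then have "((\<lambda>t. t *s e) has_derivative (\<lambda>h. h *s D \<Phi> (\<gamma> t) (w t))) (at t)"
          by (rule has_derivative_transform_within_open[OF _ open_ball t]) (rule \<gamma>)
        from has_derivative_unique[OF this line]
        have "1 *s D \<Phi> (\<gamma> t) (w t) = 1 *s e" by meson
        then show False
          using e(1) \<open>w t = 0\<close> clinD(3)[OF holomorphic_C2D(2)[OF \<Phi> \<gamma>r[OF t]]] by simp
      qed
      ultimately have "eigenvalue (DF n (\<gamma> t)) 1"
        by (auto simp: eigenvalue_def)
      then obtain b where "eigenpair (DF n (\<gamma> t)) 1 b"
        using eigenvalue_eigenpair[OF has_derivative_DF(2)[OF \<gamma>r[OF t]]] by blast
      then show ?thesis by (simp add: eigenpair_def)
    qed
    define \<delta> where "\<delta> t = det2 (DF n (\<gamma> t))" for t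
    have "(\<lambda>t. DF n (\<gamma> t) v $ j) holomorphic_on ball 0 \<epsilon>" for v j
      using w \<gamma>r by (intro holomorphic_on_D_curve[OF holomorphic_funpow open_reach open_ball]) auto
    then have "\<delta> holomorphic_on ball 0 \<epsilon>"
      unfolding \<delta>_def det2_def by (intro holomorphic_intros)
    moreover have nd: "norm (\<delta> t) = 1" if "t \<in> ball 0 \<epsilon>" for t
      using norm_det2_1[OF fixed(2)[OF that] n] by (simp add: \<delta>_def)
    ultimately have "\<delta> constant_on ball 0 \<epsilon>"
      using \<epsilon>(1) by (intro maximum_modulus_principle[of \<delta> "ball 0 \<epsilon>" "ball 0 \<epsilon>" 0]) auto
    then have \<delta>: "\<delta> t = \<delta> 0" if "t \<in> ball 0 \<epsilon>" for t
      using that \<epsilon>(1) unfolding constant_on_def by (metis centre_in_ball)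
    obtain r' where r': "r' > 0" "\<And>q. q \<in> per n \<inter> ball p r' \<Longrightarrow> \<exists>t \<in> ball 0 \<epsilon>. q = \<gamma> t"
      using close[OF \<epsilon>(1)] by blast
    have "tr2 (DF n q) = tr2 (DF n p) \<and> det2 (DF n q) = det2 (DF n p)"
      if q: "q \<in> per n \<inter> ball p r'" for q
    proof -
      obtain t where t: "t \<in> ball 0 \<epsilon>" "q = \<gamma> t" using r'(2)[OF q] by blast
      have "0 \<in> ball 0 \<epsilon>" using \<epsilon>(1) by simp
      then show ?thesis
        using \<delta>[OF t(1)] tr[OF t(1)] tr[of 0] t(2) \<gamma>0 by (simp add: \<delta>_def)
    qed
    then show ?thesis using r'(1) by blast
  qed
qed

end

section \<open>Continua of periodic points\<close>

context finite_orbit_map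
begin

lemma continuous_on_invariant_part:
  assumes "Y \<subseteq> invariant_part A"
  shows "continuous_on Y (F ^^ n)" "continuous_on Y (\<lambda>z. tr2 (DF n z))" "continuous_on Y (\<lambda>z. det2 (DF n z))"
proof -
  have "Y \<subseteq> reach n"
    using assms invariant_part_reach[of A] by blast
  then show "continuous_on Y (F ^^ n)" "continuous_on Y (\<lambda>z. tr2 (DF n z))" "continuous_on Y (\<lambda>z. det2 (DF n z))"
    using continuous_on_reach continuous_on_tr2_det2[OF holomorphic_funpow open_reach]
      continuous_on_subset by blast+
qed

lemma closedin_multipliers:
  assumes "Y \<subseteq> invariant_part A"
  shows "closedin (top_of_set Y) {q \<in> Y. (F ^^ n) q = q \<and> tr2 (DF n q) = t \<and> det2 (DF n q) = d}"
proof -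
  have "continuous_on Y (\<lambda>q. ((F ^^ n) q - q, tr2 (DF n q), det2 (DF n q)))"
    by (intro continuous_intros continuous_on_invariant_part[OF assms])
  from continuous_closedin_preimage_constant[OF this, of "(0, t, d)"]
  show ?thesis by (simp add: conj_commute cong: conj_cong)
qed

text \<open>For a value other than (2, 1), the points of \<open>Y\<close> with this trace and
  determinant form a set that is closed by continuity and open by local constancy.\<close>

lemma multipliers_constant:
  assumes Y: "connected Y" "Y \<subseteq> per n" and n: "n \<ge> 1" and pq: "p \<in> Y" "q \<in> Y"
  shows "tr2 (DF n q) = tr2 (DF n p) \<and> det2 (DF n q) = det2 (DF n p)"
proof -
  have const: "tr2 (DF n y) = tr2 (DF n x) \<and> det2 (DF n y) = det2 (DF n x)"
    if x: "x \<in> Y" "\<not> (tr2 (DF n x) = 2 \<and> det2 (DF n x) = 1)" and y: "y \<in> Y" for x y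
  proof -
    define S where "S = {q \<in> Y. (F ^^ n) q = q \<and> tr2 (DF n q) = tr2 (DF n x) \<and> det2 (DF n q) = det2 (DF n x)}"
    have YA: "Y \<subseteq> invariant_part A" using Y(2) by (auto simp: per_def)
    have "closedin (top_of_set Y) S"
      unfolding S_def by (rule closedin_multipliers[OF YA])
    moreover have "openin (top_of_set Y) S"
      unfolding openin_contains_ball
    proof (intro conjI ballI)
      fix z assume z: "z \<in> S"
      then have "z \<in> per n" "\<not> (tr2 (DF n z) = 2 \<and> det2 (DF n z) = 1)"
        using Y(2) x(2) by (auto simp: S_def)
      from locally_constant_multipliers[OF this(1) n this(2)] obtain r where
        r: "r > 0" "\<forall>q\<in>per n \<inter> ball z r. tr2 (DF n q) = tr2 (DF n z) \<and> det2 (DF n q) = det2 (DF n z)"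
        by blast
      have "ball z r \<inter> Y \<subseteq> S"
      proof
        fix q assume q: "q \<in> ball z r \<inter> Y"
        then have "q \<in> per n" using Y(2) by blast
        then show "q \<in> S" using q r(2) z unfolding S_def per_def by auto
      qed
      then show "\<exists>e>0. ball z e \<inter> Y \<subseteq> S" using r(1) by blast
    qed (auto simp: S_def)
    ultimately have "S = {} \<or> S = Y"
      using Y(1) unfolding connected_clopen by blast
    moreover have "x \<in> S" using x(1) Y(2) by (auto simp: S_def per_def)
    ultimately have "y \<in> S" using y by blast
    then show ?thesis by (simp add: S_def)
  qed
  show ?thesis
  proof (cases "tr2 (DF n p) = 2 \<and> det2 (DF n p) = 1")
    case True
    \<comment> \<open>If \<open>q\<close> were not unipotent, the argument started at
      \<open>q\<close> would give \<open>p\<close> the values of \<open>q\<close>.\<close>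
    then show ?thesis using const[OF pq(2) _ pq(1)] by metis
  next
    case False
    then show ?thesis by (rule const[OF pq(1) _ pq(2)])
  qed
qed

text \<open>The set \<open>S\<close> is clopen in \<open>Y\<close>. Near a point of \<open>S\<close>
  stability forces period \<open>n\<close>; the multipliers are carried along because stability has
  to be available again at the new points.\<close>

lemma stable_continuum:
  assumes Y: "connected Y" "Y \<subseteq> per m" and m: "m \<ge> 1"
    and p: "p \<in> Y" "p \<in> per n" "stable (DF n p)" and n: "n \<ge> 1"
  shows "Y \<subseteq> per n"
proof -
  define S where "S = {q \<in> Y. (F ^^ n) q = q \<and> tr2 (DF n q) = tr2 (DF n p) \<and> det2 (DF n q) = det2 (DF n p)}"
  have Ynm: "Y \<subseteq> per (n * m)"
    using Y(2) per_mult[of m n] by (auto simp: mult.commute)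
  have nm: "n * m \<ge> 1" using n m by simp
  have YA: "Y \<subseteq> invariant_part A" using Y(2) by (auto simp: per_def)
  have Sper: "q \<in> per n" if "q \<in> S" for q
    using that YA by (auto simp: S_def per_def)
  have "closedin (top_of_set Y) S"
    unfolding S_def by (rule closedin_multipliers[OF YA])
  moreover have "openin (top_of_set Y) S"
    unfolding openin_contains_ball
  proof (intro conjI ballI)
    fix q assume q: "q \<in> S"
    note clin = has_derivative_DF(2)[OF per_reach]
    have "stable (DF n q)"
      using p(3) stable_cong[OF clin[OF Sper[OF q]] clin[OF p(2)]] q by (simp add: S_def)
    from stable_per[OF Sper[OF q] this m] obtain r1 where
      r1: "r1 > 0" "per (n * m) \<inter> ball q r1 \<subseteq> per n" by blast
    have "\<exists>r2>0. \<forall>z \<in> Y \<inter> per n \<inter> ball q r2. tr2 (DF n z) = tr2 (DF n q) \<and> det2 (DF n z) = det2 (DF n q)"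
    proof (cases "tr2 (DF n q) = 2 \<and> det2 (DF n q) = 1")
      case False
      from locally_constant_multipliers[OF Sper[OF q] n this] show ?thesis by blast
    next
      case True
      define R where "R = {x::complex. x ^ m = 1 \<and> x \<noteq> 1}"
      have "finite R"
        unfolding R_def using m by (intro finite_subset[OF _ finite_roots_unity[of m]]) auto
      have pos: "\<forall>\<^sub>F z in nhds q. x * x - tr2 (DF n z) * x + det2 (DF n z) \<noteq> 0" if "x \<in> R" for x
      proof -
        let ?f = "\<lambda>z. x * x - tr2 (DF n z) * x + det2 (DF n z)"
        have "continuous_on (reach n) ?f"
          by (intro continuous_intros continuous_on_tr2_det2[OF holomorphic_funpow open_reach])
        then have "open (reach n \<inter> ?f -` (- {0}))"
          by (rule continuous_open_preimage[OF _ open_reach]) auto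
        moreover have "?f q = (x - 1) * (x - 1)"
          using True by (simp add: algebra_simps)
        then have "q \<in> reach n \<inter> ?f -` (- {0})"
          using that per_reach[OF Sper[OF q]] by (simp add: R_def)
        ultimately show ?thesis
          unfolding eventually_nhds by blast
      qed
      have "\<forall>\<^sub>F z in nhds q. \<forall>x\<in>R. x * x - tr2 (DF n z) * x + det2 (DF n z) \<noteq> 0"
        using \<open>finite R\<close> pos by (intro eventually_ball_finite) auto
      then obtain r2 where r2: "r2 > 0"
        "\<And>z x. dist z q < r2 \<Longrightarrow> x \<in> R \<Longrightarrow> x * x - tr2 (DF n z) * x + det2 (DF n z) \<noteq> 0"
        unfolding eventually_nhds_metric by blast
      have uni: "\<forall>c. eigenvalue (DF (n * m) z) c \<longrightarrow> c = 1" if z: "z \<in> Y" for z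
      proof -
        have "\<forall>c. eigenvalue (DF (n * m) q) c \<longrightarrow> c = 1"
        proof (intro allI impI)
          fix c assume "eigenvalue (DF (n * m) q) c"
          then obtain x where x: "eigenvalue (DF n q) x" "c = x ^ m"
            using eigenvalue_funpow[OF clin[OF Sper[OF q]]] DF_mult[OF Sper[OF q]] by metis
          have "x = 1"
            using unipotent_iff[OF clin[OF Sper[OF q]]] True x(1) by blast
          then show "c = 1" using x(2) by simp
        qed
        moreover have "q \<in> Y" using q by (simp add: S_def)
        moreover from this have "q \<in> per (n * m)" "z \<in> per (n * m)" using Ynm z by blast+
        ultimately show ?thesis
          using multipliers_constant[OF Y(1) Ynm nm \<open>q \<in> Y\<close> z]
            unipotent_iff[OF clin[of q "n * m" "n * m"]] unipotent_iff[OF clin[of z "n * m" "n * m"]]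
          by simp
      qed
      have "tr2 (DF n z) = 2 \<and> det2 (DF n z) = 1" if z: "z \<in> Y" "z \<in> per n" "z \<in> ball q r2" for z
      proof -
        have "c = 1" if c: "eigenvalue (DF n z) c" for c
        proof (rule ccontr)
          assume "c \<noteq> 1"
          obtain v where v: "v \<noteq> 0" "DF n z v = c *s v"
            using c by (auto simp: eigenvalue_def)
          then have "DF (n * m) z v = c ^ m *s v"
            using funpow_eigenvector[OF clin[OF z(2)]] by (simp add: DF_mult[OF z(2)])
          then have "c ^ m = 1"
            using uni[OF z(1)] v(1) by (auto simp: eigenvalue_def)
          then have "c \<in> R" using \<open>c \<noteq> 1\<close> by (simp add: R_def)
          obtain b where "eigenpair (DF n z) c b"
            using eigenvalue_eigenpair[OF clin[OF z(2)] c] by blast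
          then have "c * c - tr2 (DF n z) * c + det2 (DF n z) = 0"
            by (simp add: eigenpair_def algebra_simps)
          with r2(2)[OF _ \<open>c \<in> R\<close>, of z] z(3) show False
            by (simp add: dist_commute)
        qed
        then show ?thesis using unipotent_iff[OF clin[OF z(2)]] by blast
      qed
      then show ?thesis using True r2(1) by (intro exI[of _ r2]) simp
    qed
    then obtain r2 where r2: "r2 > 0"
      "\<forall>z \<in> Y \<inter> per n \<inter> ball q r2. tr2 (DF n z) = tr2 (DF n q) \<and> det2 (DF n z) = det2 (DF n q)"
      by blast
    have "ball q (min r1 r2) \<inter> Y \<subseteq> S"
    proof
      fix z assume z: "z \<in> ball q (min r1 r2) \<inter> Y"
      then have "z \<in> per n" using r1(2) Ynm by auto
      then show "z \<in> S" using z r2(2) q by (auto simp: S_def per_def)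
    qed
    then show "\<exists>e>0. ball q e \<inter> Y \<subseteq> S"
      using r1(1) r2(1) by (intro exI[of _ "min r1 r2"]) auto
  qed (auto simp: S_def)
  ultimately have "S = {} \<or> S = Y"
    using Y(1) unfolding connected_clopen by blast
  moreover have "p \<in> S" using p by (simp add: S_def per_def)
  ultimately have "S = Y" by blast
  then show ?thesis using Sper by blast
qed

text \<open>Trace and determinant are locally constant away from the value (2, 1), and by Lindelof
  countably many of the corresponding balls suffice; the exceptional value adds one point.\<close>

lemma countable_multipliers:
  assumes n: "n \<ge> 1"
  shows "countable ((\<lambda>q. (tr2 (DF n q), det2 (DF n q))) ` per n)"
proof -
  let ?\<tau> = "\<lambda>q. (tr2 (DF n q), det2 (DF n q))"
  define S where "S = {q \<in> per n. ?\<tau> q \<noteq> (2, 1)}"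
  have "\<exists>r>0. \<forall>z \<in> per n \<inter> ball q r. ?\<tau> z = ?\<tau> q" if q: "q \<in> S" for q
    using locally_constant_multipliers[of q n] q n by (auto simp: S_def)
  then obtain r where r: "\<And>q. q \<in> S \<Longrightarrow> r q > 0"
    "\<And>q z. q \<in> S \<Longrightarrow> z \<in> per n \<Longrightarrow> z \<in> ball q (r q) \<Longrightarrow> ?\<tau> z = ?\<tau> q"
    by (metis Int_iff)
  obtain \<F> where \<F>: "\<F> \<subseteq> (\<lambda>q. ball q (r q)) ` S" "countable \<F>" "\<Union>\<F> = \<Union>((\<lambda>q. ball q (r q)) ` S)"
    using Lindelof[of "(\<lambda>q. ball q (r q)) ` S"] by blast
  then obtain S' where S': "S' \<subseteq> S" "countable S'" "\<F> = (\<lambda>q. ball q (r q)) ` S'"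
    using countable_subset_image[of \<F> "\<lambda>q. ball q (r q)" S] by blast
  have "?\<tau> ` S \<subseteq> ?\<tau> ` S'"
  proof
    fix x assume "x \<in> ?\<tau> ` S"
    then obtain z where z: "z \<in> S" "x = ?\<tau> z" by blast
    have "z \<in> \<Union>\<F>"
      using z(1) r(1) unfolding \<F>(3) by (intro UN_I[of z]) auto
    then obtain q where q: "q \<in> S'" "z \<in> ball q (r q)" unfolding S'(3) by blast
    then have "?\<tau> z = ?\<tau> q"
      using r(2)[of q z] S'(1) z(1) by (auto simp: S_def)
    then show "x \<in> ?\<tau> ` S'" using z(2) q(1) by blast
  qed
  moreover have "?\<tau> ` per n \<subseteq> insert (2, 1) (?\<tau> ` S)"
    unfolding S_def by blast
  moreover have "countable (insert (2, 1) (?\<tau> ` S'))"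
    using S'(2) by simp
  ultimately show ?thesis
    by (meson countable_subset insert_mono subset_trans)
qed

end

text \<open>A variant of Sierpinski's theorem that a continuum is not a countable disjoint union of closed
  sets. The pieces \<open>Q m\<close> may overlap, but a continuum inside some \<open>Q m\<close> that meets \<open>E \<in> \<E>\<close> is
  already contained in a \<open>Q n\<close> depending on \<open>E\<close> only.\<close>

lemma avoid_closed_set:
  fixes X :: "'a::euclidean_space set"
  assumes X: "compact X" "connected X" and bad: "\<And>n. n \<in> I \<Longrightarrow> \<not> X \<subseteq> Q n"
    and closed: "\<And>n. n \<in> I \<Longrightarrow> closed (Q n)"
    and E: "closed E" "N \<in> I" "\<And>m Y. m \<in> I \<Longrightarrow> compact Y \<Longrightarrow> connected Y \<Longrightarrow> Y \<subseteq> X \<Longrightarrow> Y \<subseteq> Q m \<Longrightarrow>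
      Y \<inter> E \<noteq> {} \<Longrightarrow> Y \<subseteq> Q N"
    and pts: "\<And>p. p \<in> X \<Longrightarrow> \<exists>n\<in>I. \<forall>m\<in>I. \<forall>Y. compact Y \<and> connected Y \<and> Y \<subseteq> X \<and> Y \<subseteq> Q m \<and> p \<in> Y \<longrightarrow> Y \<subseteq> Q n"
    and cover: "\<And>p. p \<in> X \<Longrightarrow> \<exists>n\<in>I. p \<in> Q n"
  shows "\<exists>Y\<subseteq>X. compact Y \<and> connected Y \<and> Y \<inter> E = {} \<and> (\<forall>n\<in>I. \<not> Y \<subseteq> Q n)"
proof (cases "X \<inter> E = {}")
  case True
  then show ?thesis using X bad by blast
next
  case False
  then have Ene: "E \<noteq> {}" by blast
  obtain p where p: "p \<in> X" "p \<notin> Q N" using bad[OF E(2)] by blast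
  \<comment> \<open>The degenerate continuum \<open>{p}\<close> lies in some piece; if it met
    \<open>E\<close>, it would lie in \<open>Q N\<close>.\<close>
  have "p \<notin> E"
    using E(3)[of _ "{p}"] p cover[OF p(1)] by auto
  then have dp: "infdist p E > 0"
    using E(1) Ene in_closed_iff_infdist_zero[of E p] infdist_nonneg[of p E] by force
  \<comment> \<open>Scaling by the distance from \<open>p\<close> to \<open>E\<close> keeps
    \<open>p\<close> in every \<open>S k\<close>, while these sets exhaust the part of
    \<open>X\<close> outside \<open>E\<close>.\<close>
  define S where "S k = {z \<in> X. infdist p E / Suc k \<le> infdist z E}" for k :: nat
  define Y where "Y k = connected_component_set (S k) p" for k
  have small: "infdist p E / Suc k \<le> infdist p E" for k :: nat
    using dp by (simp add: divide_le_eq mult_left_le)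
  have pS: "p \<in> S k" for k
    using p(1) small by (simp add: S_def)
  have cS: "compact (S k)" for k
  proof -
    have "closed {z. infdist p E / Suc k \<le> infdist z E}"
      by (intro closed_Collect_le continuous_intros)
    then have "compact (X \<inter> {z. infdist p E / Suc k \<le> infdist z E})"
      using X(1) by blast
    then show ?thesis by (simp add: S_def Int_def)
  qed
  have Ycomp: "Y k \<in> components (S k)" for k
    using pS by (auto simp: Y_def components_def)
  have Y: "compact (Y k)" "connected (Y k)" "Y k \<subseteq> S k" "p \<in> Y k" for k
    using compact_components[OF cS Ycomp] in_components_connected[OF Ycomp]
      in_components_subset[OF Ycomp] pS by (auto simp: Y_def)
  have YX: "Y k \<subseteq> X" for k
    using Y(3) by (auto simp: S_def)
  have YE: "Y k \<inter> E = {}" for k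
  proof -
    have "0 < infdist p E / Suc k" using dp by simp
    then show ?thesis using Y(3)[of k] by (auto simp: S_def)
  qed
  show ?thesis
  proof (rule ccontr)
    assume neg: "\<not> ?thesis"
    have good: "\<exists>m\<in>I. Y k \<subseteq> Q m" for k
    proof (rule ccontr)
      assume "\<not> ?thesis"
      then have "\<forall>n\<in>I. \<not> Y k \<subseteq> Q n" by blast
      then show False
        using neg YX[of k] Y(1)[of k] Y(2)[of k] YE[of k] by blast
    qed
    \<comment> \<open>The hypothesis at the single point \<open>p\<close> gives one index for all
      \<open>Y k\<close>, so the closure of their union lies in one piece.\<close>
    obtain n where n: "n \<in> I"
      "\<forall>m\<in>I. \<forall>Y. compact Y \<and> connected Y \<and> Y \<subseteq> X \<and> Y \<subseteq> Q m \<and> p \<in> Y \<longrightarrow> Y \<subseteq> Q n"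
      using pts[OF p(1)] by (rule bexE)
    have Yn: "Y k \<subseteq> Q n" for k
    proof -
      obtain m where "m \<in> I" "Y k \<subseteq> Q m" using good by blast
      then show ?thesis
        using n(2)[THEN bspec, THEN spec, of m "Y k"] Y[of k] YX[of k] by simp
    qed
    define Z where "Z = closure (\<Union>k. Y k)"
    have YZ: "Y k \<subseteq> Z" for k
      using closure_subset[of "\<Union>k. Y k"] unfolding Z_def by blast
    have "\<Union>(range Y) \<subseteq> X" using YX by blast
    then have "Z \<subseteq> X"
      unfolding Z_def using X(1) by (intro closure_minimal) (auto intro: compact_imp_closed)
    have cZ: "compact Z"
      using X(1) \<open>Z \<subseteq> X\<close> unfolding Z_def by (metis closed_closure compact_Int_closed inf.absorb_iff2)
    have "connected (\<Union>(range Y))"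
    proof (rule connected_Union)
      show "\<Inter>(range Y) \<noteq> {}" using Y(4) by blast
    qed (use Y(2) in auto)
    then have "connected Z"
      unfolding Z_def by (rule connected_imp_connected_closure)
    have "Z \<subseteq> Q n"
      unfolding Z_def using Yn closed[OF n(1)] by (intro closure_minimal) auto
    \<comment> \<open>Boundary bumping: otherwise some clopen part of \<open>S k\<close> avoiding
      the boundary level would be clopen in \<open>X\<close>, hence equal to \<open>X\<close>,
      although \<open>X\<close> meets \<open>E\<close>.\<close>
    have bump: "\<exists>z\<in>Y k. infdist z E \<le> infdist p E / Suc k" for k
    proof (rule ccontr)
      assume "\<not> ?thesis"
      then have sub: "Y k \<subseteq> {z. infdist p E / Suc k < infdist z E}" by force
      have op: "open {z. infdist p E / Suc k < infdist z E}"
        by (intro open_Collect_less continuous_intros)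
      have "locally compact (S k)"
        using cS by (simp add: closed_imp_locally_compact compact_imp_closed)
      from Sura_Bura_clopen_subset[OF this Ycomp Y(1) op sub]
      obtain C where C: "openin (top_of_set (S k)) C" "compact C" "Y k \<subseteq> C"
        "C \<subseteq> {z. infdist p E / Suc k < infdist z E}" by blast
      then obtain O' where O': "open O'" "C = S k \<inter> O'"
        by (auto simp: openin_open)
      have "C = X \<inter> (O' \<inter> {z. infdist p E / Suc k < infdist z E})"
        using O'(2) C(4) by (auto simp: S_def)
      then have "openin (top_of_set X) C"
        using O'(1) op by (metis open_Int openin_open_Int)
      moreover have "C \<subseteq> X" using O'(2) by (auto simp: S_def)
      then have "closedin (top_of_set X) C"
        using C(2) by (simp add: compact_imp_closed closed_subset)
      ultimately have "C = {} \<or> C = X"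
        using X(2) unfolding connected_clopen by blast
      then have "C = X" using C(3) Y(4)[of k] by blast
      moreover obtain z where "z \<in> X" "z \<in> E" using False by blast
      ultimately have "infdist p E / Suc k < 0" using C(4) by auto
      then show False using dp by (simp add: divide_less_0_iff)
    qed
    have "\<exists>z\<in>Z. infdist z E \<le> 0"
    proof -
      have "continuous_on Z (\<lambda>z. infdist z E)" by (intro continuous_intros)
      moreover have "Z \<noteq> {}" using Y(4)[of 0] YZ by blast
      ultimately obtain z where z: "z \<in> Z" "\<And>y. y \<in> Z \<Longrightarrow> infdist z E \<le> infdist y E"
        using continuous_attains_inf[OF cZ] by blast
      have "infdist z E \<le> infdist p E * inverse (real (Suc k))" for k
      proof -
        obtain y where "y \<in> Y k" "infdist y E \<le> infdist p E / Suc k" using bump by blast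
        moreover from this have "y \<in> Z" using YZ by blast
        ultimately show ?thesis using z(2)[of y] by (simp add: divide_inverse)
      qed
      moreover have "(\<lambda>k. infdist p E * inverse (real (Suc k))) \<longlonglongrightarrow> infdist p E * 0"
        by (intro tendsto_intros LIMSEQ_inverse_real_of_nat)
      ultimately have "infdist z E \<le> infdist p E * 0"
        by (meson LIMSEQ_le_const)
      then show ?thesis using z(1) by auto
    qed
    then obtain z where "z \<in> Z" "infdist z E \<le> 0" by blast
    then have "z \<in> E"
      using in_closed_iff_infdist_zero[OF E(1) Ene] infdist_nonneg[of z E] by force
    then have "Z \<subseteq> Q N"
      using E(3)[OF n(1) cZ \<open>connected Z\<close> \<open>Z \<subseteq> X\<close> \<open>Z \<subseteq> Q n\<close>] \<open>z \<in> Z\<close> by blast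
    moreover have "p \<in> Z" using Y(4)[of 0] YZ by blast
    ultimately show False using p(2) by blast
  qed
qed

text \<open>Otherwise the members of \<E> can be avoided one after another by shrinking subcontinua
  that still lie in no piece. Their intersection is nonempty, yet it meets no member of the
  cover.\<close>

lemma continuum_in_single_piece:
  fixes X :: "'a::euclidean_space set"
  assumes X: "compact X" "connected X"
    and closed: "\<And>n. n \<in> I \<Longrightarrow> closed (Q n)"
    and \<E>: "countable \<E>" "X \<subseteq> \<Union>\<E>" "\<And>E. E \<in> \<E> \<Longrightarrow> closed E"
    and stab: "\<And>E. E \<in> \<E> \<Longrightarrow> \<exists>n\<in>I. \<forall>m\<in>I. \<forall>Y. compact Y \<and> connected Y \<and> Y \<subseteq> X \<and> Y \<subseteq> Q m \<and> Y \<inter> E \<noteq> {} \<longrightarrow> Y \<subseteq> Q n"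
    and cover: "\<And>p. p \<in> X \<Longrightarrow> \<exists>n\<in>I. p \<in> Q n"
    and "X \<noteq> {}"
  shows "\<exists>n\<in>I. X \<subseteq> Q n"
proof (rule ccontr)
  assume neg: "\<not> ?thesis"
  have "\<E> \<noteq> {}" using \<E>(2) \<open>X \<noteq> {}\<close> by blast
  define e where "e = from_nat_into \<E>"
  have e: "e k \<in> \<E>" "\<Union>(range e) = \<Union>\<E>" for k
    using \<open>\<E> \<noteq> {}\<close> \<E>(1) by (simp_all add: e_def from_nat_into)
  define P where "P Y \<longleftrightarrow> Y \<subseteq> X \<and> compact Y \<and> connected Y \<and> (\<forall>n\<in>I. \<not> Y \<subseteq> Q n)" for Y
  have "\<exists>Y'. P Y' \<and> Y' \<subseteq> Y \<and> Y' \<inter> e k = {}" if "P Y" for Y k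
  proof -
    have Y: "Y \<subseteq> X" "compact Y" "connected Y" "\<And>n. n \<in> I \<Longrightarrow> \<not> Y \<subseteq> Q n"
      using that by (auto simp: P_def)
    obtain N where N: "N \<in> I" "\<forall>m\<in>I. \<forall>Z. compact Z \<and> connected Z \<and> Z \<subseteq> X \<and> Z \<subseteq> Q m \<and> Z \<inter> e k \<noteq> {} \<longrightarrow> Z \<subseteq> Q N"
      using stab[OF e(1)] by blast
    have "\<exists>Z\<subseteq>Y. compact Z \<and> connected Z \<and> Z \<inter> e k = {} \<and> (\<forall>n\<in>I. \<not> Z \<subseteq> Q n)"
    proof (rule avoid_closed_set[OF Y(2,3,4) closed \<E>(3)[OF e(1)] N(1)])
      show "Z \<subseteq> Q N" if "m \<in> I" "compact Z" "connected Z" "Z \<subseteq> Y" "Z \<subseteq> Q m" "Z \<inter> e k \<noteq> {}" for m Z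
        using N(2) that Y(1) by blast
      fix p assume "p \<in> Y"
      then have "p \<in> X" using Y(1) by blast
      then show "\<exists>n\<in>I. p \<in> Q n" by (rule cover)
      obtain E where E: "E \<in> \<E>" "p \<in> E" using \<open>p \<in> X\<close> \<E>(2) by blast
      then obtain n where "n \<in> I" "\<forall>m\<in>I. \<forall>Y. compact Y \<and> connected Y \<and> Y \<subseteq> X \<and> Y \<subseteq> Q m \<and> Y \<inter> E \<noteq> {} \<longrightarrow> Y \<subseteq> Q n"
        using stab by blast
      then show "\<exists>n\<in>I. \<forall>m\<in>I. \<forall>Z. compact Z \<and> connected Z \<and> Z \<subseteq> Y \<and> Z \<subseteq> Q m \<and> p \<in> Z \<longrightarrow> Z \<subseteq> Q n"
        using E(2) Y(1) by (intro bexI[of _ n]) blast+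
    qed
    then show ?thesis using Y(1) unfolding P_def by blast
  qed
  moreover have "P X" using X neg by (simp add: P_def)
  ultimately have "\<exists>f. \<forall>k. P (f k) \<and> f (Suc k) \<subseteq> f k \<and> f (Suc k) \<inter> e k = {}"
    using dependent_nat_choice[of "\<lambda>_. P" "\<lambda>k Y Y'. Y' \<subseteq> Y \<and> Y' \<inter> e k = {}"] by blast
  then obtain f where f: "\<And>k. P (f k)" "\<And>k. f (Suc k) \<subseteq> f k" "\<And>k. f (Suc k) \<inter> e k = {}"
    by blast
  obtain n where "n \<in> I" using cover \<open>X \<noteq> {}\<close> by blast
  \<comment> \<open>The empty set would lie in every piece.\<close>
  have "f k \<noteq> {}" for k
    using f(1)[of k] \<open>n \<in> I\<close> by (auto simp: P_def)
  moreover have "compact (f k)" for k using f(1) by (simp add: P_def)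
  moreover have "f k \<subseteq> f j" if "j \<le> k" for j k
    using lift_Suc_antimono_le[of f, OF f(2) that] .
  ultimately have "\<Inter>(range f) \<noteq> {}" by (intro compact_nest) auto
  then obtain x where x: "\<And>k. x \<in> f k" by blast
  then have "x \<in> X" using f(1)[of 0] by (auto simp: P_def)
  then obtain k where "x \<in> e k" using \<E>(2) e(2) by blast
  then show False using f(3)[of k] x[of "Suc k"] by blast
qed

context finite_orbit_map
begin

text \<open>The pieces are the points of \<open>K\<close> of a given period. The countable cover
  groups points by a period \<open>n\<close> and the trace and determinant there. Each class has a
  common exponent \<open>e\<close> making its points stable for period \<open>n * e\<close>, so a
  continuum of bounded period meeting the class has period \<open>n * e\<close>.\<close>

lemma continuum_in_per:
  assumes X: "compact X" "connected X" "X \<noteq> {}" and r: "cball x r \<subseteq> A" and XK: "X \<subseteq> invariant_part (cball x r)"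
  shows "\<exists>n\<ge>1. X \<subseteq> per n"
proof -
  define K where "K = invariant_part (cball x r)"
  have KA: "K \<subseteq> invariant_part A"
    using r by (auto simp: K_def invariant_part_def)
  have clK: "closed K"
    unfolding K_def using r by (intro invariant_part_closed) auto
  define E where "E n t d = {q \<in> K. (F ^^ n) q = q \<and> tr2 (DF n q) = t \<and> det2 (DF n q) = d}" for n t d
  define \<E> where "\<E> = (\<Union>n\<in>{1..}. (\<lambda>(t, d). E n t d) ` (\<lambda>q. (tr2 (DF n q), det2 (DF n q))) ` per n)"
  have clE: "closed (E n t d)" for n t d
    unfolding E_def using closedin_closed_trans[OF closedin_multipliers[OF KA] clK] .
  have "\<exists>n\<in>{1..}. X \<subseteq> per n \<inter> K"
  proof (rule continuum_in_single_piece[OF X(1,2) _ _ _ _ _ _ X(3)])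
    show "closed (per n \<inter> K)" for n
    proof -
      have "continuous_on K (\<lambda>q. (F ^^ n) q - q)"
        by (intro continuous_intros continuous_on_invariant_part[OF KA])
      from continuous_closedin_preimage_constant[OF this, of 0]
      have "closed {q \<in> K. (F ^^ n) q - q = 0}"
        using closedin_closed_trans[OF _ clK] by blast
      moreover have "per n \<inter> K = {q \<in> K. (F ^^ n) q - q = 0}"
        using KA by (auto simp: per_def)
      ultimately show ?thesis by simp
    qed
    show "countable \<E>"
      unfolding \<E>_def by (intro countable_UN countable_image countable_multipliers) auto
    show cover: "\<exists>n\<in>{1..}. p \<in> per n \<inter> K" if "p \<in> X" for p
    proof -
      have "p \<in> K" using that XK by (auto simp: K_def)
      then obtain n where "n \<ge> 1" "(F ^^ n) p = p"
        using invariant_part_periodic[OF r, of p] by (auto simp: K_def)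
      then show ?thesis using \<open>p \<in> K\<close> KA by (intro bexI[of _ n]) (auto simp: per_def)
    qed
    show "X \<subseteq> \<Union>\<E>"
    proof
      fix p assume "p \<in> X"
      then obtain n where n: "n \<in> {1..}" "p \<in> per n \<inter> K" using cover by blast
      then have "p \<in> E n (tr2 (DF n p)) (det2 (DF n p))"
        by (simp add: E_def per_def)
      moreover have "E n (tr2 (DF n p)) (det2 (DF n p)) \<in> \<E>"
        unfolding \<E>_def using n by (intro UN_I[of n] image_eqI[of _ _ "(tr2 (DF n p), det2 (DF n p))"]) auto
      ultimately show "p \<in> \<Union>\<E>" by blast
    qed
    show "closed Z" if "Z \<in> \<E>" for Z
      using that clE by (auto simp: \<E>_def)
    fix Z assume "Z \<in> \<E>"
    then obtain n t d where Z: "n \<ge> 1" "Z = E n t d"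
      by (auto simp: \<E>_def)
    obtain e where e: "e \<ge> 1" "\<forall>L. clin L \<and> tr2 L = t \<and> det2 L = d \<longrightarrow> stable (L ^^ e)"
      using ex_stable_funpow by blast
    have ne: "n * e \<ge> 1" using Z(1) e(1) by simp
    have "Y \<subseteq> per (n * e) \<inter> K" if m: "m \<in> {1..}" and Y: "connected Y" "Y \<subseteq> X" "Y \<subseteq> per m \<inter> K" "Y \<inter> Z \<noteq> {}" for m Y
    proof -
      obtain p where p: "p \<in> Y" "p \<in> E n t d" using Y(4) Z(2) by blast
      then have pn: "p \<in> per n" using KA by (auto simp: E_def per_def)
      have "stable (DF n p ^^ e)"
        using e(2) p(2) has_derivative_DF(2)[OF per_reach[OF pn]] by (simp add: E_def)
      then have "stable (DF (n * e) p)" by (simp add: DF_mult[OF pn])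
      moreover have "p \<in> per (n * e)" using pn per_mult by blast
      moreover have "Y \<subseteq> per m" using Y(3) by blast
      moreover have "m \<ge> 1" using m by simp
      ultimately have "Y \<subseteq> per (n * e)"
        using stable_continuum[OF Y(1) _ _ p(1) _ _ ne] by blast
      then show ?thesis using Y(3) by blast
    qed
    then show "\<exists>n\<in>{1..}. \<forall>m\<in>{1..}. \<forall>Y. compact Y \<and> connected Y \<and> Y \<subseteq> X \<and> Y \<subseteq> per m \<inter> K \<and> Y \<inter> Z \<noteq> {} \<longrightarrow>
        Y \<subseteq> per n \<inter> K"
      using ne by (intro bexI[of _ "n * e"]) auto
  qed
  then show ?thesis by auto
qed

lemma ex_root_of_unity:
  assumes x: "x \<in> A" "F x = x"
  shows "\<exists>c. eigenvalue (D F x) c \<and> root_of_unity c"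
proof (rule ccontr)
  assume neg: "\<not> ?thesis"
  have D1: "DF 1 x = D F x" by simp
  have fix_x: "(F ^^ k) x = x" for k
    by (induction k) (simp_all add: x(2))
  have x1: "x \<in> per 1" using x by (simp add: per_def invariant_part_def fix_x)
  have "stable (DF 1 x)"
    using neg unfolding stable_def D1 by blast
  obtain r where r: "r > 0" "cball x r \<subseteq> A"
    using open_A x(1) open_contains_cball by blast
  obtain X where X: "compact X" "connected X" "x \<in> X" "X \<noteq> {x}" "X \<subseteq> invariant_part (cball x r)"
    using ex_invariant_continuum[OF x(2) r] by blast
  obtain n where n: "n \<ge> 1" "X \<subseteq> per n"
    using continuum_in_per[OF X(1,2) _ r(2) X(5)] X(3) by blast
  have X1: "X \<subseteq> per 1"
    using stable_continuum[OF X(2) n(2,1) X(3) x1 \<open>stable (DF 1 x)\<close>] by simp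
  have "root_of_unity 1" by (auto simp: root_of_unity_def)
  then have "\<not> eigenvalue (DF 1 x) 1" using neg unfolding D1 by blast
  from isolated_per[OF x1 this] obtain d where d: "d > 0" "per 1 \<inter> ball x d = {x}" by blast
  have "X \<inter> ball x d = {x}" using X1 X(3) d by auto
  then have "openin (top_of_set X) {x}"
    by (metis open_ball openin_open_Int)
  moreover have "closedin (top_of_set X) {x}" using X(3) by (simp add: closed_subset)
  ultimately show False
    using X(2,4) unfolding connected_clopen by blast
qed

end

section \<open>From the finite orbits property of a germ to periodicity\<close>

lemma finite_orbit_periodic:
  assumes A: "\<And>k. (F ^^ k) p \<in> A" and GF: "\<And>z. z \<in> A \<Longrightarrow> G (F z) = z"
    and fin: "finite {(F ^^ j) p | j. \<forall>k\<le>j. (F ^^ k) p \<in> B}" and "A \<subseteq> B"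
  shows "\<exists>n\<ge>1. (F ^^ n) p = p"
proof -
  have "range (\<lambda>j. (F ^^ j) p) \<subseteq> {(F ^^ j) p | j. \<forall>k\<le>j. (F ^^ k) p \<in> B}"
    using A \<open>A \<subseteq> B\<close> by blast
  then have "finite (range (\<lambda>j. (F ^^ j) p))"
    using fin finite_subset by blast
  then have "\<not> inj (\<lambda>j. (F ^^ j) p)"
    using finite_imageD[of "\<lambda>j. (F ^^ j) p" UNIV] by blast
  then obtain i j where ij: "i < j" "(F ^^ i) p = (F ^^ j) p"
    unfolding inj_def by (metis linorder_neqE_nat)
  \<comment> \<open>Applying \<open>G\<close> cancels the common initial steps, so that
    \<open>p\<close> itself is periodic and not only eventually periodic.\<close>
  have "(F ^^ (i + n)) p = (F ^^ i) p \<Longrightarrow> (F ^^ n) p = p" for i n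
  proof (induction i)
    case (Suc i)
    then have "G (F ((F ^^ (i + n)) p)) = G (F ((F ^^ i) p))" by simp
    then show ?case using Suc.IH GF A by simp
  qed simp
  from this[of i "j - i"] ij show ?thesis by (intro exI[of _ "j - i"]) auto
qed

theorem theorem3:
  fixes \<phi> :: "(C2 \<Rightarrow> C2) set"
  assumes "\<phi> \<in> Diff0"
    and "finite_orbits_property \<phi>"
  shows "(\<exists>c. eigenvalue (germ_derivative \<phi>) c \<and> root_of_unity c) \<and>
         (\<forall>c. eigenvalue (germ_derivative \<phi>) c \<longrightarrow> c \<in> sphere 0 1)"
proof -
  obtain F U V B where rep: "local_biholomorphism F U V" "germ F = \<phi>" and B: "B \<subseteq> U \<inter> V" "0 \<in> interior B"
    and fin: "finite_orbits_in F U B"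
    using assms(2) unfolding finite_orbits_property_def representative_def by blast
  define G where "G = inv_into U F"
  \<comment> \<open>The locale asks for an open domain, and an orbit that stays in \<open>A\<close>
    stays in \<open>B\<close>, where it is finite.\<close>
  define A where "A = interior B"
  have bij: "bij_betw F U V" and holF: "holomorphic_C2 F U" and holG: "holomorphic_C2 G V" and F0: "F 0 = 0"
    using rep(1) by (auto simp: local_biholomorphism_def G_def)
  have AB: "A \<subseteq> B" "A \<subseteq> U" "A \<subseteq> V" "open A" "0 \<in> A"
    using B interior_subset by (auto simp: A_def)
  have GF: "G (F z) = z" if "z \<in> A" for z
    using bij_betw_inv_into_left[OF bij] that AB by (auto simp: G_def)
  have FG: "F (G z) = z" if "z \<in> A" for z
    using bij_betw_inv_into_right[OF bij] that AB by (auto simp: G_def)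
  have fin': "finite (pos_orbit F B p)" "finite (pos_orbit G B p)" if "p \<in> A" for p
    using fin that AB by (auto simp: finite_orbits_in_def orbit_def G_def)
  have holA: "holomorphic_C2 F A" "holomorphic_C2 G A"
    using holF holG AB holomorphic_C2_subset by blast+
  interpret finite_orbit_map F G A
  proof unfold_locales
    show "\<exists>n\<ge>1. (F ^^ n) p = p" if "\<And>k. (F ^^ k) p \<in> A" for p
      using fin'(1)[of p] that[of 0] AB(1)
      by (intro finite_orbit_periodic[OF that GF, of B]) (auto simp: pos_orbit_def)
    show "\<exists>n\<ge>1. (G ^^ n) p = p" if "\<And>k. (G ^^ k) p \<in> A" for p
      using fin'(2)[of p] that[of 0] AB(1)
      by (intro finite_orbit_periodic[OF that FG, of B]) (auto simp: pos_orbit_def)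
  qed (use AB GF FG holA holomorphic_C2_continuous_on in auto)
  have "germ_derivative \<phi> = D F 0"
    using germ_derivative_eq[OF holomorphic_C2D(1)[OF holA(1) AB(5)]] rep(2) by simp
  moreover have "0 \<in> per 1"
    using AB(5) F0 by (intro per_I) (auto simp: reach_def)
  then have "norm c = 1" if "eigenvalue (D F 0) c" for c
    using eigenvalue_norm_1[of 0 1 c] that by simp
  ultimately show ?thesis
    using ex_root_of_unity[OF AB(5) F0] by simp
qed

end
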